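(* Consider the problem $\min_{x\in\operatorname{dom}\Psi}[\tilde f(x)=f(x)+\Psi(x)]$, where $f$ is convex with $\operatorname{dom} f=\mathbb{E}$ and satisfies the Regularity Assumption, and $\Psi$ is a closed convex function; let $x^*$ be an optimal solution and $D=\beta_d(x_0,x^* )$. Let either of the methods PGM or DGM (described in the context) be run with accuracy $\epsilon>0$ and $0<L_0\le\gamma_f(\epsilon)$. Let the number of iterations $k\ge1$ satisfy $$2\,\hat\mu\Big(2\sqrt{\tfrac Dk}\Big)\ \le\ \epsilon,$$ equivalently $k\ge \frac4\epsilon\gamma_f(\epsilon)D=4D/s_f^2(\epsilon/2)$. Then $k$ iterations are sufficient for getting an $\epsilon$-solution in function value: $\tilde f_{k-1}^*-\tilde f(x^* )\le\epsilon$, where, with $S_{k-1}=\sum_{i=0}^{k-1}\frac1{L_{i+1}}$, we put $\tilde f_{k-1}^*=\frac1{S_{k-1}}\sum_{i=0}^{k-1}\frac1{L_{i+1}}\tilde f(x_{i+1})$ for PGM and $\tilde f_{k-1}^*=\frac1{S_{k-1}}\sum_{i=0}^{k-1}\frac1{L_{i+1}}\tilde f(y_i)$ for DGM.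
   Context: $\mathbb{E}$ is a finite-dimensional real linear space with dual $\mathbb{E}^*$; $\langle g,x\rangle$ is the value of $g\in\mathbb{E}^*$ at $x$; $\|\cdot\|$ is an arbitrary fixed norm on $\mathbb{E}$. $f:\mathbb{E}\to\mathbb{R}$ is convex and not affine; $\nabla f(x)\in\partial f(x)$ is its gradient (subgradient). $\Psi$ is closed convex with $\operatorname{dom}\Psi\subseteq\mathbb{E}$, $\operatorname{int}(\operatorname{dom}\Psi)\ne\emptyset$. Global Curvature Bound: $\hat\mu(t)=\sup\big\{\frac{\alpha f(x)+(1-\alpha)f(y)-f(\alpha x+(1-\alpha)y)}{\alpha(1-\alpha)}:\ x,y\in\mathbb{E},\ \alpha\in(0,1),\ \|x-y\|\le t\big\}$, $t\ge0$. Regularity Assumption: $\hat\mu(t)<+\infty$ for all $t\ge0$ and $\lim_{\tau\to+0}\frac1\tau\hat\mu(\tau)=0$. The complexity gauge $s_f$ is the inverse function of $\hat\mu$: $\hat\mu(s_f(\epsilon))=\epsilon$, $\epsilon\ge0$. For $t>0$: $\gamma_f(t)=t/s_f^2(t/2)$. Prox-function: $d$ is a differentiable convex function on $\operatorname{dom}\Psi$ with $d(y)\ge d(x)+\langle\nabla d(x),y-x\rangle+\frac12\|y-x\|^2$ for $x\in\operatorname{int}(\operatorname{dom}\Psi)$, $y\in\operatorname{dom}\Psi$; $x_0=\operatorname{arg\,min}_{x\in\operatorname{dom}\Psi}d(x)$ and $d(x_0)=0$. Bregman distance: $\beta_d(x,y)=d(y)-d(x)-\langle\nabla d(x),y-x\rangle$.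 Let $\psi_M(x,y)=f(x)+\langle\nabla f(x),y-x\rangle+M\beta_d(x,y)+\Psi(y)$, $\mathcal{B}_M(x)=\operatorname{arg\,min}_{y\in\operatorname{dom}\Psi}\psi_M(x,y)$ (assumed to be computable), $\psi_M^*(x)=\psi_M(x,\mathcal{B}_M(x))$. PGM (Universal Primal Gradient Method). Start from $x_0$ above; for $k\ge0$: find the smallest integer $i_k\ge0$ such that for $x_k^+=\mathcal{B}_{2^{i_k}L_k}(x_k)$ we have $f(x_k^+)\le f(x_k)+\langle\nabla f(x_k),x_k^+-x_k\rangle+2^{i_k-1}L_k\|x_k^+-x_k\|^2+\frac\epsilon2$; set $x_{k+1}=x_k^+$, $L_{k+1}=2^{i_k-1}L_k$. DGM (Universal Dual Gradient Method). Start from $x_0$ above, $\phi_0(x)=\beta_d(x_0,x)$; for $k\ge0$: find the smallest integer $i_k\ge0$ such that for the point $x_{k,i_k}=\operatorname{arg\,min}_{x\in\operatorname{dom}\Psi}\big\{\phi_k(x)+\frac1{2^{i_k}L_k}[f(x_k)+\langle\nabla f(x_k),x-x_k\rangle+\Psi(x)]\big\}$ we have $\tilde f(\mathcal{B}_{2^{i_k}L_k}(x_{k,i_k}))\le\psi^*_{2^{i_k}L_k}(x_{k,i_k})+\frac\epsilon2$; set $x_{k+1}=x_{k,i_k}$, $y_k=\mathcal{B}_{2^{i_k}L_k}(x_{k,i_k})$, $L_{k+1}=2^{i_k-1}L_k$, $\phi_{k+1}(x)=\phi_k(x)+\frac1{2L_{k+1}}[f(x_k)+\langle\nabla f(x_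k),x-x_k\rangle+\Psi(x)]$.
   Formalization: In DGM the acceptance test and the output use the Bregman step at the current point x_k, i.e. f̃(B_M(x_k)) ≤ ψ*_M(x_k)+ε/2 and y_k = B_M(x_k) with M = 2^{i_k}L_k, instead of at x_{k,i_k}, for which the claimed bound fails; PGM is unchanged. *)

theory Defs
  imports "HOL-Analysis.Analysis"
begin

text \<open>
  The space is a type of class \<open>real_normed_vector\<close>, assumed finite-dimensional in the theorem; its
  norm is the arbitrary fixed norm, and its dual is the type of bounded linear functionals
  (finite dimension makes every linear functional bounded).

  The extended-valued function \<open>\<Psi>\<close> is represented by its effective domain \<open>Q\<close> together with a
  real-valued function that is only ever used on \<open>Q\<close>.
\<close>

definition curvature_values :: "('a::real_normed_vector \<Rightarrow> real) \<Rightarrow> real \<Rightarrow> real set" where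
  "curvature_values f t =
     {(\<alpha> * f x + (1 - \<alpha>) * f y - f (\<alpha> *\<^sub>R x + (1 - \<alpha>) *\<^sub>R y)) / (\<alpha> * (1 - \<alpha>)) | x y \<alpha>.
        0 < \<alpha> \<and> \<alpha> < 1 \<and> norm (x - y) \<le> t}"

text \<open>A real supremum: it is the true one whenever the set is bounded above, which is the
  finiteness part of the regularity assumption.\<close>

definition curvature_bound :: "('a::real_normed_vector \<Rightarrow> real) \<Rightarrow> real \<Rightarrow> real" where
  "curvature_bound f t = Sup (curvature_values f t)"

definition regularity :: "('a::real_normed_vector \<Rightarrow> real) \<Rightarrow> bool" where
  "regularity f \<longleftrightarrow> (\<forall>t\<ge>0. bdd_above (curvature_values f t)) \<and>
     ((\<lambda>t. curvature_bound f t / t) \<longlongrightarrow> 0) (at_right 0)"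

definition complexity_gauge :: "('a::real_normed_vector \<Rightarrow> real) \<Rightarrow> real \<Rightarrow> real" where
  "complexity_gauge f = the_inv_into {0..} (curvature_bound f)"

definition gamma_gauge :: "('a::real_normed_vector \<Rightarrow> real) \<Rightarrow> real \<Rightarrow> real" where
  "gamma_gauge f t = t / (complexity_gauge f (t / 2))\<^sup>2"

definition subgradient_selection ::
  "('a::real_normed_vector \<Rightarrow> real) \<Rightarrow> ('a \<Rightarrow> 'a \<Rightarrow>\<^sub>L real) \<Rightarrow> bool" where
  "subgradient_selection f gf \<longleftrightarrow> (\<forall>x y. f y \<ge> f x + blinfun_apply (gf x) (y - x))"

text \<open>Differentiability on the domain is taken relative to \<open>Q\<close>, so that the gradient, and with it the
  Bregman distance, also makes sense at boundary points of \<open>Q\<close> that belong to \<open>Q\<close>. As \<open>Q\<close> is convex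
  with nonempty interior, this gradient is unique.\<close>

definition prox_function ::
  "'a::real_normed_vector set \<Rightarrow> ('a \<Rightarrow> real) \<Rightarrow> ('a \<Rightarrow> 'a \<Rightarrow>\<^sub>L real) \<Rightarrow> bool" where
  "prox_function Q d gd \<longleftrightarrow> convex_on Q d \<and>
     (\<forall>x\<in>Q. (d has_derivative blinfun_apply (gd x)) (at x within Q)) \<and>
     (\<forall>x\<in>interior Q. \<forall>y\<in>Q. d y \<ge> d x + blinfun_apply (gd x) (y - x) + 1/2 * (norm (y - x))\<^sup>2)"

definition bregman ::
  "('a::real_normed_vector \<Rightarrow> real) \<Rightarrow> ('a \<Rightarrow> 'a \<Rightarrow>\<^sub>L real) \<Rightarrow> 'a \<Rightarrow> 'a \<Rightarrow> real" where
  "bregman d gd x y = d y - d x - blinfun_apply (gd x) (y - x)"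

definition composite_linearization ::
  "('a::real_normed_vector \<Rightarrow> real) \<Rightarrow> ('a \<Rightarrow> 'a \<Rightarrow>\<^sub>L real) \<Rightarrow> ('a \<Rightarrow> real) \<Rightarrow> 'a \<Rightarrow> 'a \<Rightarrow> real" where
  "composite_linearization f gf \<Psi> x y = f x + blinfun_apply (gf x) (y - x) + \<Psi> y"

definition bregman_model ::
  "('a::real_normed_vector \<Rightarrow> real) \<Rightarrow> ('a \<Rightarrow> 'a \<Rightarrow>\<^sub>L real) \<Rightarrow> ('a \<Rightarrow> real) \<Rightarrow>
   ('a \<Rightarrow> real) \<Rightarrow> ('a \<Rightarrow> 'a \<Rightarrow>\<^sub>L real) \<Rightarrow> real \<Rightarrow> 'a \<Rightarrow> 'a \<Rightarrow> real" where
  "bregman_model f gf \<Psi> d gd M x y = composite_linearization f gf \<Psi> x y + M * bregman d gd x y"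

definition bregman_map ::
  "('a::real_normed_vector \<Rightarrow> real) \<Rightarrow> ('a \<Rightarrow> 'a \<Rightarrow>\<^sub>L real) \<Rightarrow> 'a set \<Rightarrow> ('a \<Rightarrow> real) \<Rightarrow>
   ('a \<Rightarrow> real) \<Rightarrow> ('a \<Rightarrow> 'a \<Rightarrow>\<^sub>L real) \<Rightarrow> real \<Rightarrow> 'a \<Rightarrow> 'a" where
  "bregman_map f gf Q \<Psi> d gd M x = arg_min_on (bregman_model f gf \<Psi> d gd M x) Q"

text \<open>In both methods \<open>i k\<close> is the line-search exponent and \<open>M\<close> the trial constant \<open>2 ^ i k * L k\<close>. A
  run is constrained only during its first \<open>n\<close> iterations.\<close>

definition pgm_accepts ::
  "('a::real_normed_vector \<Rightarrow> real) \<Rightarrow> ('a \<Rightarrow> 'a \<Rightarrow>\<^sub>L real) \<Rightarrow> 'a set \<Rightarrow> ('a \<Rightarrow> real) \<Rightarrow>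
   ('a \<Rightarrow> real) \<Rightarrow> ('a \<Rightarrow> 'a \<Rightarrow>\<^sub>L real) \<Rightarrow> real \<Rightarrow> 'a \<Rightarrow> real \<Rightarrow> bool" where
  "pgm_accepts f gf Q \<Psi> d gd \<epsilon> x M \<longleftrightarrow>
     (let y = bregman_map f gf Q \<Psi> d gd M x
      in f y \<le> f x + blinfun_apply (gf x) (y - x) + M / 2 * (norm (y - x))\<^sup>2 + \<epsilon> / 2)"

definition pgm_run ::
  "('a::real_normed_vector \<Rightarrow> real) \<Rightarrow> ('a \<Rightarrow> 'a \<Rightarrow>\<^sub>L real) \<Rightarrow> 'a set \<Rightarrow> ('a \<Rightarrow> real) \<Rightarrow>
   ('a \<Rightarrow> real) \<Rightarrow> ('a \<Rightarrow> 'a \<Rightarrow>\<^sub>L real) \<Rightarrow> real \<Rightarrow> 'a \<Rightarrow> real \<Rightarrow> nat \<Rightarrow>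
   (nat \<Rightarrow> 'a) \<Rightarrow> (nat \<Rightarrow> real) \<Rightarrow> (nat \<Rightarrow> nat) \<Rightarrow> bool" where
  "pgm_run f gf Q \<Psi> d gd \<epsilon> x0 L0 n x L i \<longleftrightarrow> x 0 = x0 \<and> L 0 = L0 \<and>
     (\<forall>k<n. pgm_accepts f gf Q \<Psi> d gd \<epsilon> (x k) (2 ^ i k * L k) \<and>
            (\<forall>j<i k. \<not> pgm_accepts f gf Q \<Psi> d gd \<epsilon> (x k) (2 ^ j * L k)) \<and>
            x (Suc k) = bregman_map f gf Q \<Psi> d gd (2 ^ i k * L k) (x k) \<and>
            L (Suc k) = 2 ^ i k * L k / 2)"

primrec dgm_phi ::
  "('a::real_normed_vector \<Rightarrow> real) \<Rightarrow> ('a \<Rightarrow> 'a \<Rightarrow>\<^sub>L real) \<Rightarrow> ('a \<Rightarrow> real) \<Rightarrow>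
   ('a \<Rightarrow> real) \<Rightarrow> ('a \<Rightarrow> 'a \<Rightarrow>\<^sub>L real) \<Rightarrow> 'a \<Rightarrow> (nat \<Rightarrow> 'a) \<Rightarrow> (nat \<Rightarrow> real) \<Rightarrow> nat \<Rightarrow> 'a \<Rightarrow> real" where
  "dgm_phi f gf \<Psi> d gd x0 x L 0 = (\<lambda>z. bregman d gd x0 z)"
| "dgm_phi f gf \<Psi> d gd x0 x L (Suc k) =
     (\<lambda>z. dgm_phi f gf \<Psi> d gd x0 x L k z
          + 1 / (2 * L (Suc k)) * composite_linearization f gf \<Psi> (x k) z)"

definition dgm_trial ::
  "('a::real_normed_vector \<Rightarrow> real) \<Rightarrow> ('a \<Rightarrow> 'a \<Rightarrow>\<^sub>L real) \<Rightarrow> 'a set \<Rightarrow> ('a \<Rightarrow> real) \<Rightarrow>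
   ('a \<Rightarrow> real) \<Rightarrow> real \<Rightarrow> 'a \<Rightarrow> 'a" where
  "dgm_trial f gf Q \<Psi> \<phi> M x =
     arg_min_on (\<lambda>z. \<phi> z + 1 / M * composite_linearization f gf \<Psi> x z) Q"

definition dgm_accepts ::
  "('a::real_normed_vector \<Rightarrow> real) \<Rightarrow> ('a \<Rightarrow> 'a \<Rightarrow>\<^sub>L real) \<Rightarrow> 'a set \<Rightarrow> ('a \<Rightarrow> real) \<Rightarrow>
   ('a \<Rightarrow> real) \<Rightarrow> ('a \<Rightarrow> 'a \<Rightarrow>\<^sub>L real) \<Rightarrow> real \<Rightarrow> 'a \<Rightarrow> real \<Rightarrow> bool" where
  "dgm_accepts f gf Q \<Psi> d gd \<epsilon> z M \<longleftrightarrow>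
     (let y = bregman_map f gf Q \<Psi> d gd M z
      in f y + \<Psi> y \<le> bregman_model f gf \<Psi> d gd M z y + \<epsilon> / 2)"

text \<open>
  The Bregman step of the line-search test, which also yields the output point \<open>y k\<close>, is taken at
  the current point \<open>x k\<close>. The method is sometimes printed with the trial point
  (\<open>dgm_trial\<close>, that is, \<open>x (Suc k)\<close>) in this place. This is a slip: the estimate
  \<open>min \<phi> (Suc k) \<ge> min (\<phi> k) + 1 / (2 * L (Suc k)) * \<psi>\<^sup>*\<close> behind the rate involves
  \<open>\<psi>\<^sup>*\<close> at \<open>x k\<close>, and with the trial point the rate fails. For the function \<open>f\<close> on the real line
  with \<open>f 0 = 0\<close> and derivative \<open>max (- 1) (min 2 x)\<close>, \<open>\<Psi> = 0\<close>, \<open>d x = (x - 2)\<^sup>2 / 2\<close>, \<open>\<epsilon> = 8\<close>,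
  \<open>L 0 = 1 / 20\<close> and one iteration, the trial point is \<open>- 38\<close>, the test there accepts \<open>i 0 = 0\<close>, and
  the output would be \<open>- 18\<close> with function value \<open>17.5\<close>, while the minimum of \<open>f\<close> is \<open>0\<close>.
\<close>

definition dgm_run ::
  "('a::real_normed_vector \<Rightarrow> real) \<Rightarrow> ('a \<Rightarrow> 'a \<Rightarrow>\<^sub>L real) \<Rightarrow> 'a set \<Rightarrow> ('a \<Rightarrow> real) \<Rightarrow>
   ('a \<Rightarrow> real) \<Rightarrow> ('a \<Rightarrow> 'a \<Rightarrow>\<^sub>L real) \<Rightarrow> real \<Rightarrow> 'a \<Rightarrow> real \<Rightarrow> nat \<Rightarrow>
   (nat \<Rightarrow> 'a) \<Rightarrow> (nat \<Rightarrow> 'a) \<Rightarrow> (nat \<Rightarrow> real) \<Rightarrow> (nat \<Rightarrow> nat) \<Rightarrow> bool" where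
  "dgm_run f gf Q \<Psi> d gd \<epsilon> x0 L0 n x y L i \<longleftrightarrow> x 0 = x0 \<and> L 0 = L0 \<and>
     (\<forall>k<n. dgm_accepts f gf Q \<Psi> d gd \<epsilon> (x k) (2 ^ i k * L k) \<and>
            (\<forall>j<i k. \<not> dgm_accepts f gf Q \<Psi> d gd \<epsilon> (x k) (2 ^ j * L k)) \<and>
            x (Suc k) = dgm_trial f gf Q \<Psi> (dgm_phi f gf \<Psi> d gd x0 x L k) (2 ^ i k * L k) (x k) \<and>
            y k = bregman_map f gf Q \<Psi> d gd (2 ^ i k * L k) (x k) \<and>
            L (Suc k) = 2 ^ i k * L k / 2)"

definition averaged_value :: "('a \<Rightarrow> real) \<Rightarrow> (nat \<Rightarrow> real) \<Rightarrow> nat \<Rightarrow> (nat \<Rightarrow> 'a) \<Rightarrow> real" where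
  "averaged_value F L k z =
     1 / (\<Sum>i<k. 1 / L (Suc i)) * (\<Sum>i<k. 1 / L (Suc i) * F (z i))"

end

theory Submission
  imports Defs
begin

text \<open>
  Write \<open>\<mu>\<close> for the global curvature bound of \<open>f\<close>. Everything about \<open>\<mu>\<close> follows from the two scaling
  laws \<open>\<tau> * \<mu> t \<le> \<mu> (\<tau> * t) \<le> \<tau>\<^sup>2 * \<mu> t\<close> for \<open>\<tau> \<ge> 1\<close> (\<open>curvature_bound_scale_ge\<close>,
  \<open>curvature_bound_scale_le\<close>). Since \<open>f\<close> is not affine, they make \<open>\<mu>\<close> a strictly increasing bijection
  of the half-line, so the complexity gauge is its genuine inverse. With \<open>s\<close> the gauge at
  \<open>\<epsilon> / 2\<close>, the condition on \<open>k\<close> says \<open>2 * sqrt (D / k) \<le> s\<close>, that is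
  \<open>k \<ge> 4 * D / s\<^sup>2\<close>.

  The regularity assumption makes \<open>f\<close> differentiable with linearization error at most \<open>\<mu> r\<close> at
  distance \<open>r\<close>. By the quadratic scaling law this error is at most \<open>M / 2\<close> times the squared distance plus
  \<open>\<epsilon> / 2\<close> as soon as \<open>M \<ge> \<gamma> = gamma_gauge f \<epsilon>\<close> (\<open>gamma_gauge_upper_model\<close>). Hence both line
  searches accept every trial constant from \<open>\<gamma>\<close> on, and doubling never lets \<open>L k\<close> exceed
  \<open>\<gamma>\<close> (\<open>line_search_bound\<close>).

  An accepted step is a step of a mirror descent method with an inexact model of \<open>f\<close>. The minimizer
  of a convex function plus \<open>M * d\<close> beats any other point by \<open>M\<close> times their Bregman distance
  (\<open>three_point\<close>). In the primal method this gives a telescoping sum of Bregman distances to the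
  solution (\<open>pgm_total\<close>); in the dual method it shows that the minimum of the estimating function
  grows by at least the weighted objective value of the output (\<open>dgm_total\<close>). In both cases the
  sum of \<open>1 / (2 * L (j + 1))\<close> times the gap minus \<open>\<epsilon> / 2\<close> is at most \<open>D\<close>, and as the weights
  \<open>1 / L (j + 1)\<close> are at least \<open>1 / \<gamma>\<close>, the average gap is at most
  \<open>2 * D * \<gamma> / k + \<epsilon> / 2 \<le> \<epsilon>\<close> (\<open>averaged_value_gap\<close>).

  Two points are easily overlooked. The subproblems must have minimizers at all: this is
  \<open>prox_regularized_minimizer\<close>, which obtains the limit of a minimizing sequence from strong convexity
  and completeness. And the iterates may lie on the boundary of \<open>Q\<close>, where strong convexity of \<open>d\<close> has
  to be derived from the interior (\<open>prox_strong_convexity\<close>).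
\<close>

section \<open>The global curvature bound\<close>

lemma curvature_bound_upper:
  assumes "regularity f" "0 < \<alpha>" "\<alpha> < 1" "norm (x - y) \<le> t"
  shows "\<alpha> * f x + (1 - \<alpha>) * f y - f (\<alpha> *\<^sub>R x + (1 - \<alpha>) *\<^sub>R y)
           \<le> \<alpha> * (1 - \<alpha>) * curvature_bound f t"
proof -
  have "0 \<le> t" using assms(4) norm_ge_zero order_trans by blast
  then have "bdd_above (curvature_values f t)"
    using assms(1) by (simp add: regularity_def)
  moreover have "(\<alpha> * f x + (1 - \<alpha>) * f y - f (\<alpha> *\<^sub>R x + (1 - \<alpha>) *\<^sub>R y)) / (\<alpha> * (1 - \<alpha>))
      \<in> curvature_values f t"
    using assms unfolding curvature_values_def by blast
  ultimately have "(\<alpha> * f x + (1 - \<alpha>) * f y - f (\<alpha> *\<^sub>R x + (1 - \<alpha>) *\<^sub>R y)) / (\<alpha> * (1 - \<alpha>))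
      \<le> curvature_bound f t"
    unfolding curvature_bound_def by (rule cSup_upper[rotated])
  then show ?thesis using assms by (simp add: divide_le_eq mult.commute)
qed

lemma curvature_bound_least:
  fixes f :: "'a::real_normed_vector \<Rightarrow> real"
  assumes "0 \<le> t"
    and "\<And>x y \<alpha>. 0 < \<alpha> \<Longrightarrow> \<alpha> < 1 \<Longrightarrow> norm (x - y) \<le> t \<Longrightarrow>
      \<alpha> * f x + (1 - \<alpha>) * f y - f (\<alpha> *\<^sub>R x + (1 - \<alpha>) *\<^sub>R y) \<le> \<alpha> * (1 - \<alpha>) * c"
  shows "curvature_bound f t \<le> c"
  unfolding curvature_bound_def
proof (rule cSup_least)
  have "norm (0 - 0 :: 'a) \<le> t" "0 < (1/2::real)" "(1/2::real) < 1" using assms(1) by auto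
  then show "curvature_values f t \<noteq> {}" unfolding curvature_values_def by blast
next
  fix v assume "v \<in> curvature_values f t"
  then obtain x y \<alpha> where *: "0 < \<alpha>" "\<alpha> < 1" "norm (x - y) \<le> t" and
    v: "v = (\<alpha> * f x + (1 - \<alpha>) * f y - f (\<alpha> *\<^sub>R x + (1 - \<alpha>) *\<^sub>R y)) / (\<alpha> * (1 - \<alpha>))"
    unfolding curvature_values_def by blast
  show "v \<le> c" unfolding v using assms(2)[OF *] * by (simp add: divide_le_eq mult.commute)
qed

lemma curvature_bound_nonneg:
  assumes "regularity f" "0 \<le> t" shows "0 \<le> curvature_bound f t"
  using curvature_bound_upper[OF assms(1), of "1/2" 0 0 t] assms(2) by simp

lemma curvature_bound_zero:
  assumes "regularity f" shows "curvature_bound f 0 = 0"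
proof (rule antisym)
  show "curvature_bound f 0 \<le> 0"
    by (rule curvature_bound_least) (auto simp: algebra_simps simp flip: scaleR_left_distrib)
qed (simp add: assms curvature_bound_nonneg)

lemma curvature_bound_mono:
  assumes "regularity f" "0 \<le> s" "s \<le> t" shows "curvature_bound f s \<le> curvature_bound f t"
  using assms by (intro curvature_bound_least curvature_bound_upper) auto

text \<open>Stretching a triple \<open>x\<close>, \<open>z = \<alpha>x + (1 - \<alpha>)y\<close>, \<open>y\<close> by the factor \<open>\<tau>\<close> about its inner point
  \<open>z\<close> keeps \<open>\<alpha>\<close>, and by convexity the increments of \<open>f\<close> away from \<open>z\<close> grow at least by \<open>\<tau>\<close>.\<close>

lemma curvature_bound_scale_ge:
  fixes f :: "'a::real_normed_vector \<Rightarrow> real"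
  assumes reg: "regularity f" and cvx: "convex_on UNIV f" and "0 \<le> t" "1 \<le> \<tau>"
  shows "\<tau> * curvature_bound f t \<le> curvature_bound f (\<tau> * t)"
proof -
  have "curvature_bound f t \<le> curvature_bound f (\<tau> * t) / \<tau>"
  proof (rule curvature_bound_least[OF \<open>0 \<le> t\<close>])
    fix x y :: 'a and \<alpha> :: real
    assume a: "0 < \<alpha>" "\<alpha> < 1" and n: "norm (x - y) \<le> t"
    define z where "z = \<alpha> *\<^sub>R x + (1 - \<alpha>) *\<^sub>R y"
    define X where "X = z + \<tau> *\<^sub>R (x - z)"
    define Y where "Y = z + \<tau> *\<^sub>R (y - z)"
    have push: "\<tau> * (f w - f z) \<le> f (z + \<tau> *\<^sub>R (w - z)) - f z" for w
    proof -
      define c W where "c = 1 / \<tau>" and "W = z + \<tau> *\<^sub>R (w - z)"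
      have c: "0 < c" "c \<le> 1" "\<tau> = 1 / c" using \<open>1 \<le> \<tau>\<close> by (auto simp: c_def)
      have "f ((1 - c) *\<^sub>R z + c *\<^sub>R W) \<le> (1 - c) * f z + c * f W"
        using c by (intro convex_onD[OF cvx]) auto
      moreover have "(1 - c) *\<^sub>R z + c *\<^sub>R W = w"
        using c by (simp add: W_def algebra_simps)
      ultimately have "f w - f z \<le> c * (f W - f z)" by (simp add: algebra_simps)
      then have "f w - f z \<le> (f W - f z) / \<tau>" by (simp add: c_def)
      then have "\<tau> * (f w - f z) \<le> f W - f z"
        using \<open>1 \<le> \<tau>\<close> by (simp add: pos_le_divide_eq mult.commute)
      then show ?thesis by (simp add: W_def)
    qed
    have XY: "X - Y = \<tau> *\<^sub>R (x - y)" by (simp add: X_def Y_def algebra_simps)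
    have Z: "\<alpha> *\<^sub>R X + (1 - \<alpha>) *\<^sub>R Y = z"
      by (simp add: X_def Y_def z_def algebra_simps)
    have "\<tau> * (\<alpha> * f x + (1 - \<alpha>) * f y - f z)
        = \<alpha> * (\<tau> * (f x - f z)) + (1 - \<alpha>) * (\<tau> * (f y - f z))" by (simp add: algebra_simps)
    also have "\<dots> \<le> \<alpha> * (f X - f z) + (1 - \<alpha>) * (f Y - f z)"
      using push[of x] push[of y] a by (intro add_mono mult_left_mono) (auto simp: X_def Y_def)
    also have "\<dots> = \<alpha> * f X + (1 - \<alpha>) * f Y - f (\<alpha> *\<^sub>R X + (1 - \<alpha>) *\<^sub>R Y)"
      unfolding Z by (simp add: algebra_simps)
    also have "\<dots> \<le> \<alpha> * (1 - \<alpha>) * curvature_bound f (\<tau> * t)"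
      using n \<open>1 \<le> \<tau>\<close> by (intro curvature_bound_upper[OF reg a]) (simp add: XY)
    finally show "\<alpha> * f x + (1 - \<alpha>) * f y - f (\<alpha> *\<^sub>R x + (1 - \<alpha>) *\<^sub>R y)
        \<le> \<alpha> * (1 - \<alpha>) * (curvature_bound f (\<tau> * t) / \<tau>)"
      using \<open>1 \<le> \<tau>\<close> by (simp add: z_def field_simps)
  qed
  then show ?thesis using \<open>1 \<le> \<tau>\<close> by (simp add: field_simps)
qed

text \<open>A maximum principle. If \<open>\<psi>\<close> had a positive maximum, look at its smallest maximizer: it is the
  interior point of some unit chord inside the interval, and convexity along that chord forces its
  left end to be a maximizer as well.\<close>

lemma unit_chord_convex_nonpos:
  fixes \<psi> :: "real \<Rightarrow> real"
  assumes cont: "continuous_on {0..\<tau>} \<psi>" and ends: "\<psi> 0 \<le> 0" "\<psi> \<tau> \<le> 0" and "1 \<le> \<tau>"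
    and chord: "\<And>u \<alpha>. 0 \<le> u \<Longrightarrow> u + 1 \<le> \<tau> \<Longrightarrow> 0 < \<alpha> \<Longrightarrow> \<alpha> < 1 \<Longrightarrow>
      \<psi> (u + \<alpha>) \<le> (1 - \<alpha>) * \<psi> u + \<alpha> * \<psi> (u + 1)"
    and s: "0 \<le> s" "s \<le> \<tau>"
  shows "\<psi> s \<le> 0"
proof (rule ccontr)
  assume neg: "\<not> \<psi> s \<le> 0"
  obtain m where m: "m \<in> {0..\<tau>}" "\<And>r. r \<in> {0..\<tau>} \<Longrightarrow> \<psi> r \<le> \<psi> m"
    using continuous_attains_sup[OF compact_Icc _ cont] \<open>1 \<le> \<tau>\<close> by auto
  define A where "A = {r \<in> {0..\<tau>}. \<psi> r = \<psi> m}"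
  have "A = {0..\<tau>} \<inter> \<psi> -` {\<psi> m}" by (auto simp: A_def)
  then have "closed A" using continuous_closed_preimage[OF cont] by simp
  moreover have "bounded A" by (rule bounded_subset[OF bounded_closed_interval[of 0 \<tau>]]) (auto simp: A_def)
  ultimately have "compact A" by (simp add: compact_eq_bounded_closed)
  moreover have "A \<noteq> {}" using m by (auto simp: A_def)
  ultimately obtain l where l: "l \<in> A" "\<And>r. r \<in> A \<Longrightarrow> l \<le> r"
    using compact_attains_inf[of A] by metis
  have pos: "0 < \<psi> m" using m(2)[of s] neg s by auto
  have "l \<noteq> 0" "l \<noteq> \<tau>" using l(1) ends pos by (auto simp: A_def)
  then have l01: "0 < l" "l < \<tau>" using l(1) by (auto simp: A_def)
  (* left end of a unit chord inside the interval that has l in its interior *)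
  define u where "u = max 0 (min (l - 1/2) (\<tau> - 1))"
  have u: "0 \<le> u" "u + 1 \<le> \<tau>" "u < l" "l < u + 1"
    using l01 \<open>1 \<le> \<tau>\<close> unfolding u_def by (auto simp: max_def min_def)
  have "\<psi> (u + (l - u)) \<le> (1 - (l - u)) * \<psi> u + (l - u) * \<psi> (u + 1)"
    using u by (intro chord) auto
  moreover have "\<psi> (u + (l - u)) = \<psi> m" using l(1) by (simp add: A_def)
  moreover have "(l - u) * \<psi> (u + 1) \<le> (l - u) * \<psi> m" using u by (intro mult_left_mono m) auto
  ultimately have "(1 - (l - u)) * \<psi> m \<le> (1 - (l - u)) * \<psi> u" by (simp add: algebra_simps)
  then have "\<psi> m \<le> \<psi> u" using u by (simp add: mult_le_cancel_left)
  then have "u \<in> A" using m(2)[of u] u by (auto simp: A_def intro: antisym)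
  then show False using l(2)[of u] u by simp
qed

text \<open>On a segment of length \<open>\<sigma>t\<close>, \<open>\<sigma> > 1\<close>, parametrized by \<open>[0, \<sigma>]\<close>, let \<open>\<psi>(s)\<close> be the gap between
  the chord and \<open>f\<close>, minus \<open>c * s * (\<sigma> - s)\<close> with \<open>c\<close> the curvature bound at \<open>t\<close>. The subtracted
  parabola has chord gap \<open>c * \<beta> * (1 - \<beta>)\<close> on every unit chord, which is exactly what the curvature
  bound allows for \<open>f\<close>. Hence \<open>\<psi>\<close> is convex along unit chords, vanishes at both ends, and is
  nonpositive by the maximum principle. At \<open>s = \<alpha>\<sigma>\<close> this is the claim.\<close>

lemma curvature_bound_scale_le:
  fixes f :: "'a::real_normed_vector \<Rightarrow> real"
  assumes reg: "regularity f" and cvx: "convex_on UNIV f" and t: "0 < t" and \<tau>: "1 \<le> \<tau>"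
  shows "curvature_bound f (\<tau> * t) \<le> \<tau>\<^sup>2 * curvature_bound f t"
proof (rule curvature_bound_least)
  show "0 \<le> \<tau> * t" using t \<tau> by simp
next
  fix x y :: 'a and \<alpha> :: real
  assume a: "0 < \<alpha>" "\<alpha> < 1" and n: "norm (x - y) \<le> \<tau> * t"
  define c where "c = curvature_bound f t"
  have c0: "0 \<le> c" using curvature_bound_nonneg[OF reg] t by (simp add: c_def)
  show "\<alpha> * f x + (1 - \<alpha>) * f y - f (\<alpha> *\<^sub>R x + (1 - \<alpha>) *\<^sub>R y) \<le> \<alpha> * (1 - \<alpha>) * (\<tau>\<^sup>2 * curvature_bound f t)"
  proof (cases "norm (x - y) \<le> t")
    case True
    have "\<alpha> * f x + (1 - \<alpha>) * f y - f (\<alpha> *\<^sub>R x + (1 - \<alpha>) *\<^sub>R y) \<le> \<alpha> * (1 - \<alpha>) * c"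
      unfolding c_def by (rule curvature_bound_upper[OF reg a True])
    also have "\<dots> \<le> \<alpha> * (1 - \<alpha>) * (\<tau>\<^sup>2 * c)"
      using a c0 \<tau> mult_right_mono[of 1 "\<tau>\<^sup>2" c] by (intro mult_left_mono) auto
    finally show ?thesis by (simp add: c_def)
  next
    case False
    define \<sigma> where "\<sigma> = norm (x - y) / t"
    have \<sigma>: "1 < \<sigma>" "\<sigma> \<le> \<tau>" "norm (x - y) = \<sigma> * t"
      using False n t by (auto simp: \<sigma>_def field_simps)
    define h where "h = (1 / \<sigma>) *\<^sub>R (x - y)"
    have nh: "norm h = t" using \<sigma> t by (simp add: h_def)
    define g where "g = (\<lambda>s. f (y + s *\<^sub>R h))"
    have gconv: "convex_on UNIV g"
    proof (rule convex_onI)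
      fix r a b :: real assume r: "0 < r" "r < 1"
      have "f ((1 - r) *\<^sub>R (y + a *\<^sub>R h) + r *\<^sub>R (y + b *\<^sub>R h))
          \<le> (1 - r) * f (y + a *\<^sub>R h) + r * f (y + b *\<^sub>R h)"
        using r by (intro convex_onD[OF cvx]) auto
      moreover have "(1 - r) *\<^sub>R (y + a *\<^sub>R h) + r *\<^sub>R (y + b *\<^sub>R h)
          = y + ((1 - r) *\<^sub>R a + r *\<^sub>R b) *\<^sub>R h" by (simp add: algebra_simps)
      ultimately show "g ((1 - r) *\<^sub>R a + r *\<^sub>R b) \<le> (1 - r) * g a + r * g b" by (simp add: g_def)
    qed simp
    have gcont: "continuous_on {0..\<sigma>} g"
      using convex_on_continuous[OF open_UNIV gconv] continuous_on_subset by blast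
    define \<psi> where "\<psi> = (\<lambda>s. (1 - s / \<sigma>) * g 0 + s / \<sigma> * g \<sigma> - g s - c * (s * (\<sigma> - s)))"
    have "\<psi> (\<alpha> * \<sigma>) \<le> 0"
    proof (rule unit_chord_convex_nonpos[where \<tau> = \<sigma> and \<psi> = \<psi> and s = "\<alpha> * \<sigma>"])
      show "continuous_on {0..\<sigma>} \<psi>"
        unfolding \<psi>_def using \<sigma> by (intro continuous_intros gcont) auto
      show "\<psi> 0 \<le> 0" "\<psi> \<sigma> \<le> 0" using \<sigma> by (auto simp: \<psi>_def)
      show "1 \<le> \<sigma>" "0 \<le> \<alpha> * \<sigma>" "\<alpha> * \<sigma> \<le> \<sigma>" using \<sigma> a by auto
    next
      fix u \<beta> :: real assume "0 \<le> u" "u + 1 \<le> \<sigma>" and \<beta>: "0 < \<beta>" "\<beta> < 1"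
      have "\<beta> * f (y + (u + 1) *\<^sub>R h) + (1 - \<beta>) * f (y + u *\<^sub>R h)
          - f (\<beta> *\<^sub>R (y + (u + 1) *\<^sub>R h) + (1 - \<beta>) *\<^sub>R (y + u *\<^sub>R h)) \<le> \<beta> * (1 - \<beta>) * c"
        unfolding c_def by (rule curvature_bound_upper[OF reg \<beta>]) (simp add: algebra_simps nh)
      moreover have "\<beta> *\<^sub>R (y + (u + 1) *\<^sub>R h) + (1 - \<beta>) *\<^sub>R (y + u *\<^sub>R h) = y + (u + \<beta>) *\<^sub>R h"
        by (simp add: algebra_simps)
      ultimately have g: "\<beta> * g (u + 1) + (1 - \<beta>) * g u - g (u + \<beta>) \<le> \<beta> * (1 - \<beta>) * c"
        by (simp add: g_def)
      have "(1 - \<beta>) * \<psi> u + \<beta> * \<psi> (u + 1) - \<psi> (u + \<beta>)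
          = c * (\<beta> * (1 - \<beta>)) - (\<beta> * g (u + 1) + (1 - \<beta>) * g u - g (u + \<beta>))"
        using \<sigma> unfolding \<psi>_def by (simp add: field_simps)
      then show "\<psi> (u + \<beta>) \<le> (1 - \<beta>) * \<psi> u + \<beta> * \<psi> (u + 1)" using g by (simp add: mult.commute)
    qed
    moreover have "g 0 = f y" "g \<sigma> = f x" using \<sigma> by (auto simp: g_def h_def)
    moreover have "g (\<alpha> * \<sigma>) = f (\<alpha> *\<^sub>R x + (1 - \<alpha>) *\<^sub>R y)"
      using \<sigma> by (simp add: g_def h_def algebra_simps)
    ultimately have "\<alpha> * f x + (1 - \<alpha>) * f y - f (\<alpha> *\<^sub>R x + (1 - \<alpha>) *\<^sub>R y)
        \<le> c * (\<alpha> * \<sigma> * (\<sigma> - \<alpha> * \<sigma>))"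
      using \<sigma> by (simp add: \<psi>_def)
    also have "\<dots> = \<alpha> * (1 - \<alpha>) * (\<sigma>\<^sup>2 * c)" by (simp add: power2_eq_square algebra_simps)
    also have "\<dots> \<le> \<alpha> * (1 - \<alpha>) * (\<tau>\<^sup>2 * c)"
      using a c0 \<sigma> by (intro mult_left_mono mult_right_mono power_mono) auto
    finally show ?thesis by (simp add: c_def)
  qed
qed

text \<open>By quadratic scaling, one zero makes the curvature bound vanish everywhere, so that \<open>f\<close> is
  midpoint affine along lines through the origin and thus cannot rise above its supporting
  affine function there.\<close>

lemma curvature_bound_pos:
  fixes f :: "'a::real_normed_vector \<Rightarrow> real"
  assumes reg: "regularity f" and cvx: "convex_on UNIV f" and sub: "subgradient_selection f gf"
    and not_affine: "\<not> (\<exists>(g :: 'a \<Rightarrow>\<^sub>L real) c. \<forall>x. f x = blinfun_apply g x + c)"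
    and t: "0 < t"
  shows "0 < curvature_bound f t"
proof (rule ccontr)
  assume "\<not> 0 < curvature_bound f t"
  then have zero: "curvature_bound f t = 0" using curvature_bound_nonneg[OF reg, of t] t by linarith
  have "f x = blinfun_apply (gf 0) x + f 0" for x
  proof (rule antisym)
    define \<tau> where "\<tau> = max 1 (norm (x - - x) / t)"
    have \<tau>: "1 \<le> \<tau>" "norm (x - - x) \<le> \<tau> * t" using t by (auto simp: \<tau>_def max_def field_simps)
    have "curvature_bound f (\<tau> * t) \<le> 0"
      using curvature_bound_scale_le[OF reg cvx t \<tau>(1)] zero by simp
    moreover have "1/2 * f x + (1 - 1/2) * f (- x) - f ((1/2) *\<^sub>R x + (1 - 1/2) *\<^sub>R (- x))
        \<le> 1/2 * (1 - 1/2) * curvature_bound f (\<tau> * t)"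
      using \<tau> by (intro curvature_bound_upper[OF reg]) auto
    ultimately have "f x + f (- x) \<le> 2 * f 0" by simp
    moreover have "f 0 + blinfun_apply (gf 0) (- x - 0) \<le> f (- x)"
      using sub unfolding subgradient_selection_def by blast
    ultimately show "f x \<le> blinfun_apply (gf 0) x + f 0" by (simp add: blinfun.minus_right)
    have "f 0 + blinfun_apply (gf 0) (x - 0) \<le> f x"
      using sub unfolding subgradient_selection_def by blast
    then show "blinfun_apply (gf 0) x + f 0 \<le> f x" by simp
  qed
  then show False using not_affine by blast
qed

text \<open>Monotonicity and quadratic scaling squeeze the value at \<open>r\<close> between the multiples
  \<open>min 1 (r/t)\<^sup>2\<close> and \<open>max 1 (r/t)\<^sup>2\<close> of the value at \<open>t\<close>.\<close>

lemma curvature_bound_continuous: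
  fixes f :: "'a::real_normed_vector \<Rightarrow> real"
  assumes reg: "regularity f" and cvx: "convex_on UNIV f" and b: "0 < b"
  shows "continuous_on {b..} (curvature_bound f)"
proof -
  have "isCont (curvature_bound f) t" if t: "0 < t" for t
  proof -
    define c where "c = curvature_bound f t"
    have "(curvature_bound f \<longlongrightarrow> c) (at t)"
    proof (rule tendsto_sandwich[where f = "\<lambda>r. min 1 ((r/t)\<^sup>2) * c" and h = "\<lambda>r. max 1 ((r/t)\<^sup>2) * c"])
      have c0: "0 \<le> c" using curvature_bound_nonneg[OF reg] t by (simp add: c_def)
      have ev: "\<forall>\<^sub>F r in at t. 0 < r" using order_tendstoD(1)[OF tendsto_ident_at t] .
      show "\<forall>\<^sub>F r in at t. curvature_bound f r \<le> max 1 ((r/t)\<^sup>2) * c" using ev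
      proof eventually_elim
        case (elim r)
        show ?case
        proof (cases "r \<le> t")
          case True
          then have "curvature_bound f r \<le> 1 * c" using curvature_bound_mono[OF reg] elim by (simp add: c_def)
          also have "\<dots> \<le> max 1 ((r/t)\<^sup>2) * c" using c0 by (intro mult_right_mono) auto
          finally show ?thesis .
        next
          case False
          then have "curvature_bound f r \<le> (r/t)\<^sup>2 * c"
            using curvature_bound_scale_le[OF reg cvx t, of "r/t"] t by (simp add: c_def)
          also have "\<dots> \<le> max 1 ((r/t)\<^sup>2) * c" using c0 by (intro mult_right_mono) auto
          finally show ?thesis .
        qed
      qed
      show "\<forall>\<^sub>F r in at t. min 1 ((r/t)\<^sup>2) * c \<le> curvature_bound f r" using ev
      proof eventually_elim
        case (elim r)
        show ?case
        proof (cases "r \<le> t")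
          case True
          then have "c \<le> (t/r)\<^sup>2 * curvature_bound f r"
            using curvature_bound_scale_le[OF reg cvx elim, of "t/r"] elim by (simp add: c_def)
          then have "(r/t)\<^sup>2 * c \<le> curvature_bound f r" using elim t by (simp add: field_simps)
          moreover have "min 1 ((r/t)\<^sup>2) * c \<le> (r/t)\<^sup>2 * c" using c0 by (intro mult_right_mono) auto
          ultimately show ?thesis by linarith
        next
          case False
          have "min 1 ((r/t)\<^sup>2) * c \<le> 1 * c" using c0 by (intro mult_right_mono) auto
          also have "\<dots> \<le> curvature_bound f r" using False curvature_bound_mono[OF reg] t by (simp add: c_def)
          finally show ?thesis .
        qed
      qed
      show "((\<lambda>r. min 1 ((r/t)\<^sup>2) * c) \<longlongrightarrow> c) (at t)" "((\<lambda>r. max 1 ((r/t)\<^sup>2) * c) \<longlongrightarrow> c) (at t)"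
        using t by (auto intro!: tendsto_eq_intros)
    qed
    then show ?thesis by (simp add: isCont_def c_def)
  qed
  then show ?thesis using b by (intro continuous_at_imp_continuous_on) auto
qed

lemma curvature_bound_strict_mono:
  fixes f :: "'a::real_normed_vector \<Rightarrow> real"
  assumes reg: "regularity f" and cvx: "convex_on UNIV f" and sub: "subgradient_selection f gf"
    and not_affine: "\<not> (\<exists>(g :: 'a \<Rightarrow>\<^sub>L real) c. \<forall>x. f x = blinfun_apply g x + c)"
    and st: "0 \<le> s" "s < t"
  shows "curvature_bound f s < curvature_bound f t"
proof (cases "s = 0")
  case True
  then show ?thesis using curvature_bound_pos[OF assms(1-4)] curvature_bound_zero[OF reg] st by auto
next
  case False
  then have s: "0 < s" using st by simp
  have pos: "0 < curvature_bound f s" by (rule curvature_bound_pos[OF assms(1-4) s])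
  have "1 * curvature_bound f s < t/s * curvature_bound f s"
    using pos s st by (intro mult_strict_right_mono) auto
  also have "\<dots> \<le> curvature_bound f (t/s * s)"
    using s st by (intro curvature_bound_scale_ge[OF reg cvx]) auto
  finally show ?thesis using s by simp
qed

text \<open>The gauge is specified as the inverse of a function on the half-line; strict monotonicity makes
  it single-valued, and continuity together with at least linear growth makes every positive value
  attained.\<close>

lemma complexity_gauge_inverse:
  fixes f :: "'a::real_normed_vector \<Rightarrow> real"
  assumes reg: "regularity f" and cvx: "convex_on UNIV f" and sub: "subgradient_selection f gf"
    and not_affine: "\<not> (\<exists>(g :: 'a \<Rightarrow>\<^sub>L real) c. \<forall>x. f x = blinfun_apply g x + c)"
    and e: "0 < e"
  shows "curvature_bound f (complexity_gauge f e) = e" "0 < complexity_gauge f e"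
proof -
  define \<mu> where "\<mu> = curvature_bound f"
  have inj: "inj_on \<mu> {0..}"
    using curvature_bound_strict_mono[OF assms(1-4)] unfolding \<mu>_def
    by (intro linorder_inj_onI) (force)+
  have m1: "0 < \<mu> 1" unfolding \<mu>_def by (rule curvature_bound_pos[OF assms(1-4)]) simp
  (* linear scaling from the point 1 down to b and up to B brackets the value e *)
  define b where "b = 1 / max 1 (\<mu> 1 / e)"
  define B where "B = max 1 (e / \<mu> 1)"
  have b: "0 < b" "b \<le> 1" by (auto simp: b_def)
  have B: "1 \<le> B" by (simp add: B_def)
  have "1 / b * \<mu> b \<le> \<mu> (1 / b * b)"
    unfolding \<mu>_def using b by (intro curvature_bound_scale_ge[OF reg cvx]) auto
  then have "\<mu> b * max 1 (\<mu> 1 / e) \<le> \<mu> 1" using b by (simp add: b_def mult.commute)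
  moreover have "\<mu> b * (\<mu> 1 / e) \<le> \<mu> b * max 1 (\<mu> 1 / e)"
    using curvature_bound_nonneg[OF reg, of b] b by (intro mult_left_mono) (auto simp: \<mu>_def)
  ultimately have "\<mu> b * (\<mu> 1 / e) \<le> \<mu> 1" by linarith
  then have lo: "\<mu> b \<le> e" using m1 e by (simp add: field_simps)
  have "B * \<mu> 1 \<le> \<mu> (B * 1)"
    unfolding \<mu>_def using B by (intro curvature_bound_scale_ge[OF reg cvx]) auto
  moreover have "e / \<mu> 1 * \<mu> 1 \<le> B * \<mu> 1" using m1 by (intro mult_right_mono) (auto simp: B_def)
  ultimately have hi: "e \<le> \<mu> B" using m1 by simp
  have "continuous_on {b..B} \<mu>"
    using curvature_bound_continuous[OF reg cvx b(1)] continuous_on_subset unfolding \<mu>_def by fastforce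
  then obtain s where s: "b \<le> s" "\<mu> s = e" using IVT'[of \<mu> b e B] lo hi b B by auto
  have "the_inv_into {0..} \<mu> e = s"
    using the_inv_into_f_f[OF inj, of s] s b by auto
  then have "complexity_gauge f e = s" by (simp add: complexity_gauge_def \<mu>_def)
  then show "curvature_bound f (complexity_gauge f e) = e" "0 < complexity_gauge f e"
    using s b by (auto simp: \<mu>_def)
qed

section \<open>A quadratic upper model of the smooth part\<close>

text \<open>With \<open>h = y - x\<close> and \<open>r\<close> its norm, the difference quotient of \<open>f\<close> at \<open>x\<close> along \<open>\<delta>h\<close> is
  compared twice with the curvature bound. On
  the segment from \<open>x\<close> to \<open>y\<close>, it is at least \<open>f y - f x\<close> minus \<open>(1 - \<delta>)\<close> times the bound. On the
  short segment from \<open>x - \<delta>h\<close> to \<open>x + \<delta>h\<close>, it exceeds the value of the subgradient by at most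
  a multiple of \<open>\<mu>(2r\<delta>) / (2r\<delta>)\<close>, which tends to zero: this is where the limit in the regularity
  assumption enters, and it amounts to differentiability of \<open>f\<close>.\<close>

lemma linearization_error_le_curvature_bound:
  fixes f :: "'a::real_normed_vector \<Rightarrow> real"
  assumes reg: "regularity f" and sub: "subgradient_selection f gf"
  shows "f y \<le> f x + blinfun_apply (gf x) (y - x) + curvature_bound f (norm (y - x))"
proof (cases "y = x")
  case True
  then show ?thesis using curvature_bound_nonneg[OF reg, of 0] by simp
next
  case False
  define h where "h = y - x"
  define r where "r = norm h"
  have r: "0 < r" using False by (simp add: r_def h_def)
  define \<mu> where "\<mu> = curvature_bound f"
  have bound: "f y - f x - gf x h \<le> r * (\<mu> (2 * r * \<delta>) / (2 * r * \<delta>)) + (1 - \<delta>) * \<mu> r"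
    if \<delta>: "0 < \<delta>" "\<delta> < 1" for \<delta>
  proof -
    have "(1 - \<delta>) * f x + (1 - (1 - \<delta>)) * f y - f ((1 - \<delta>) *\<^sub>R x + (1 - (1 - \<delta>)) *\<^sub>R y)
        \<le> (1 - \<delta>) * (1 - (1 - \<delta>)) * \<mu> r"
      unfolding \<mu>_def using \<delta>
      by (intro curvature_bound_upper[OF reg]) (auto simp: r_def h_def norm_minus_commute)
    moreover have "(1 - \<delta>) *\<^sub>R x + (1 - (1 - \<delta>)) *\<^sub>R y = x + \<delta> *\<^sub>R h"
      by (simp add: h_def algebra_simps)
    ultimately have 1: "\<delta> * (f y - f x) \<le> f (x + \<delta> *\<^sub>R h) - f x + \<delta> * ((1 - \<delta>) * \<mu> r)"
      by (simp add: algebra_simps)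
    have "1/2 * f (x + \<delta> *\<^sub>R h) + (1 - 1/2) * f (x - \<delta> *\<^sub>R h)
        - f ((1/2) *\<^sub>R (x + \<delta> *\<^sub>R h) + (1 - 1/2) *\<^sub>R (x - \<delta> *\<^sub>R h))
        \<le> 1/2 * (1 - 1/2) * \<mu> (2 * r * \<delta>)"
      unfolding \<mu>_def
    proof (intro curvature_bound_upper[OF reg])
      have "x + \<delta> *\<^sub>R h - (x - \<delta> *\<^sub>R h) = (2 * \<delta>) *\<^sub>R h" by (simp add: algebra_simps flip: scaleR_2)
      then show "norm (x + \<delta> *\<^sub>R h - (x - \<delta> *\<^sub>R h)) \<le> 2 * r * \<delta>" using \<delta> by (simp add: r_def)
    qed auto
    moreover have "(1/2) *\<^sub>R (x + \<delta> *\<^sub>R h) + (1 - 1/2) *\<^sub>R (x - \<delta> *\<^sub>R h) = x"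
      by (simp add: algebra_simps flip: scaleR_left_distrib)
    ultimately have 2: "f (x + \<delta> *\<^sub>R h) + f (x - \<delta> *\<^sub>R h) - 2 * f x \<le> \<mu> (2 * r * \<delta>) / 2"
      by (simp add: algebra_simps)
    have "f x + blinfun_apply (gf x) ((x - \<delta> *\<^sub>R h) - x) \<le> f (x - \<delta> *\<^sub>R h)"
      using sub unfolding subgradient_selection_def by blast
    then have "f x - \<delta> * gf x h \<le> f (x - \<delta> *\<^sub>R h)"
      by (simp add: blinfun.minus_right blinfun.scaleR_right)
    then have "\<delta> * (f y - f x) \<le> \<delta> * gf x h + \<mu> (2 * r * \<delta>) / 2 + \<delta> * ((1 - \<delta>) * \<mu> r)"
      using 1 2 by linarith
    also have "\<dots> = \<delta> * (gf x h + r * (\<mu> (2 * r * \<delta>) / (2 * r * \<delta>)) + (1 - \<delta>) * \<mu> r)"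
      using \<delta> r by (simp add: field_simps)
    finally show ?thesis using \<delta> by simp
  qed
  have "((\<lambda>\<delta>. r * (\<mu> (2 * r * \<delta>) / (2 * r * \<delta>)) + (1 - \<delta>) * \<mu> r)
      \<longlongrightarrow> r * 0 + (1 - 0) * \<mu> r) (at_right 0)"
  proof (intro tendsto_intros)
    have "((\<lambda>t. \<mu> t / t) \<longlongrightarrow> 0) (at_right 0)" using reg by (simp add: regularity_def \<mu>_def)
    moreover have "filterlim (\<lambda>\<delta>. 2 * r * \<delta>) (at_right 0) (at_right 0)"
      unfolding filterlim_at
      using r by (auto intro!: tendsto_eq_intros simp: eventually_at_filter)
    ultimately show "((\<lambda>\<delta>. \<mu> (2 * r * \<delta>) / (2 * r * \<delta>)) \<longlongrightarrow> 0) (at_right 0)"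
      by (rule filterlim_compose)
  qed
  moreover have "\<forall>\<^sub>F \<delta> in at_right 0.
      f y - f x - gf x h \<le> r * (\<mu> (2 * r * \<delta>) / (2 * r * \<delta>)) + (1 - \<delta>) * \<mu> r"
    using eventually_at_right_less[of 0] eventually_at_right_real[of 0 1]
    by (rule eventually_elim2) (use bound in auto)
  ultimately have "f y - f x - gf x h \<le> r * 0 + (1 - 0) * \<mu> r"
    by (rule tendsto_lowerbound) simp
  then show ?thesis by (simp add: \<mu>_def r_def h_def)
qed

text \<open>Let \<open>s\<close> be the gauge at \<open>\<epsilon> / 2\<close>. Up to distance \<open>s\<close> the linearization error is at most \<open>\<epsilon> / 2\<close>;
  beyond, quadratic scaling bounds it by \<open>(\<epsilon> / 2) * (r / s)\<^sup>2\<close>, which is the quadratic term for the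
  constant \<open>gamma_gauge f \<epsilon> = \<epsilon> / s\<^sup>2\<close>.\<close>

lemma gamma_gauge_upper_model:
  fixes f :: "'a::real_normed_vector \<Rightarrow> real"
  assumes reg: "regularity f" and cvx: "convex_on UNIV f" and sub: "subgradient_selection f gf"
    and not_affine: "\<not> (\<exists>(g :: 'a \<Rightarrow>\<^sub>L real) c. \<forall>x. f x = blinfun_apply g x + c)"
    and e: "0 < \<epsilon>" and M: "gamma_gauge f \<epsilon> \<le> M"
  shows "f y \<le> f x + blinfun_apply (gf x) (y - x) + M / 2 * (norm (y - x))\<^sup>2 + \<epsilon> / 2"
proof -
  define r where "r = norm (y - x)"
  define s where "s = complexity_gauge f (\<epsilon> / 2)"
  have s: "curvature_bound f s = \<epsilon> / 2" "0 < s"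
    using complexity_gauge_inverse[OF assms(1-4)] e by (auto simp: s_def)
  have \<gamma>: "gamma_gauge f \<epsilon> = \<epsilon> / s\<^sup>2" by (simp add: gamma_gauge_def s_def)
  have r: "0 \<le> r" by (simp add: r_def)
  have "curvature_bound f r \<le> gamma_gauge f \<epsilon> / 2 * r\<^sup>2 + \<epsilon> / 2"
  proof (cases "r \<le> s")
    case True
    then have "curvature_bound f r \<le> \<epsilon> / 2" using curvature_bound_mono[OF reg r] s by metis
    then show ?thesis using e by (simp add: \<gamma> add_increasing)
  next
    case False
    then have "curvature_bound f (r / s * s) \<le> (r / s)\<^sup>2 * curvature_bound f s"
      using s by (intro curvature_bound_scale_le[OF reg cvx]) auto
    then have "curvature_bound f r \<le> gamma_gauge f \<epsilon> / 2 * r\<^sup>2"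
      using s by (simp add: \<gamma> field_simps)
    then show ?thesis using e by simp
  qed
  also have "\<dots> \<le> M / 2 * r\<^sup>2 + \<epsilon> / 2" using M by (simp add: mult_right_mono)
  finally show ?thesis
    using linearization_error_le_curvature_bound[OF reg sub, of y x] by (simp add: r_def)
qed

section \<open>Strong convexity of the prox-function\<close>

lemma interior_shrink:
  fixes Q :: "'a::real_normed_vector set"
  assumes Q: "convex Q" "x \<in> Q" and y: "y \<in> interior Q" and \<delta>: "0 < \<delta>" "\<delta> \<le> 1"
  shows "x + \<delta> *\<^sub>R (y - x) \<in> interior Q"
proof -
  obtain r where r: "0 < r" "ball y r \<subseteq> Q" using y by (auto simp: mem_interior)
  have "ball (x + \<delta> *\<^sub>R (y - x)) (\<delta> * r) \<subseteq> Q"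
  proof
    fix w assume w: "w \<in> ball (x + \<delta> *\<^sub>R (y - x)) (\<delta> * r)"
    define v where "v = y + (1 / \<delta>) *\<^sub>R (w - (x + \<delta> *\<^sub>R (y - x)))"
    have "norm (w - (x + \<delta> *\<^sub>R (y - x))) < \<delta> * r" using w by (simp add: dist_norm norm_minus_commute)
    moreover have "dist y v = norm (w - (x + \<delta> *\<^sub>R (y - x))) / \<delta>"
      using \<delta> by (simp add: v_def dist_norm)
    ultimately have "v \<in> ball y r" using \<delta> by (simp add: divide_less_eq mult.commute)
    then have "v \<in> Q" using r by auto
    then have "(1 - \<delta>) *\<^sub>R x + \<delta> *\<^sub>R v \<in> Q" using \<delta> Q by (intro convexD) auto
    moreover have "(1 - \<delta>) *\<^sub>R x + \<delta> *\<^sub>R v = w" using \<delta> by (simp add: v_def algebra_simps)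
    ultimately show "w \<in> Q" by simp
  qed
  moreover have "0 < \<delta> * r" using \<delta> r by simp
  ultimately show ?thesis by (auto simp: mem_interior)
qed

lemma directional_derivative:
  fixes d :: "'a::real_normed_vector \<Rightarrow> real"
  assumes Q: "convex Q" "x \<in> Q" "y \<in> Q" and der: "(d has_derivative d') (at x within Q)"
  shows "((\<lambda>\<delta>. (d (x + \<delta> *\<^sub>R (y - x)) - d x) / \<delta>) \<longlongrightarrow> d' (y - x)) (at_right 0)"
proof -
  define g where "g = (\<lambda>\<delta>::real. x + \<delta> *\<^sub>R (y - x))"
  have sub: "g ` {0..1} \<subseteq> Q"
  proof
    fix w assume "w \<in> g ` {0..1}"
    then obtain \<delta> where \<delta>: "0 \<le> \<delta>" "\<delta> \<le> 1" "w = g \<delta>" by auto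
    have "(1 - \<delta>) *\<^sub>R x + \<delta> *\<^sub>R y \<in> Q" using \<delta> Q by (intro convexD) auto
    then show "w \<in> Q" by (simp add: \<delta> g_def algebra_simps)
  qed
  have "(d has_derivative d') (at (g 0) within g ` {0..1})"
    using has_derivative_subset[OF der sub] by (simp add: g_def)
  moreover have "(g has_derivative (\<lambda>\<delta>. \<delta> *\<^sub>R (y - x))) (at 0 within {0..1})"
    unfolding g_def by (auto intro!: derivative_eq_intros)
  ultimately have "(d \<circ> g has_derivative d' \<circ> (\<lambda>\<delta>. \<delta> *\<^sub>R (y - x))) (at 0 within {0..1})"
    by (intro diff_chain_within)
  moreover have "d' \<circ> (\<lambda>\<delta>. \<delta> *\<^sub>R (y - x)) = (*) (d' (y - x))"
    using linear_cmul[OF has_derivative_linear[OF der]] by (auto simp: fun_eq_iff)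
  ultimately have "(d \<circ> g has_field_derivative d' (y - x)) (at 0 within {0..1})"
    by (simp add: has_field_derivative_def)
  then have "((\<lambda>\<delta>. (d (g \<delta>) - d x) / \<delta>) \<longlongrightarrow> d' (y - x)) (at 0 within {0..1})"
    by (simp add: has_field_derivative_iff g_def)
  moreover have "at 0 within {0..1} = at_right (0::real)"
    by (rule at_within_Icc_at_right) simp
  ultimately show ?thesis by (simp add: g_def)
qed

text \<open>The definition grants this inequality for interior \<open>x\<close> only, whereas the iterates may lie on the
  boundary of \<open>Q\<close>. For interior \<open>p\<close>, the inequality at the interior points of the segment from \<open>x\<close>
  to \<open>p\<close> gives strong convexity along it, and the limit of the difference quotients at \<open>x\<close> transfers
  it to the gradient at \<open>x\<close>. An arbitrary \<open>y\<close> is approached from inside along the segment to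
  an interior point, where convexity of \<open>d\<close> controls the values.\<close>

lemma prox_strong_convexity:
  fixes Q :: "'a::real_normed_vector set"
  assumes prox: "prox_function Q d gd" and int: "interior Q \<noteq> {}" and x: "x \<in> Q" and y: "y \<in> Q"
  shows "1/2 * (norm (y - x))\<^sup>2 \<le> bregman d gd x y"
proof -
  have cvx: "convex_on Q d" and Q: "convex Q"
    using prox by (auto simp: prox_function_def convex_on_def)
  have to_interior: "d x + blinfun_apply (gd x) (p - x) + 1/2 * (norm (p - x))\<^sup>2 \<le> d p"
    if p: "p \<in> interior Q" for p
  proof -
    define h where "h = p - x"
    have pQ: "p \<in> Q" using p interior_subset by blast
    have quot: "(d (x + \<delta> *\<^sub>R h) - d x) / \<delta> \<le> d p - d x - 1/2 * (1 - \<delta>) * (norm h)\<^sup>2"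
      if \<delta>: "0 < \<delta>" "\<delta> < 1" for \<delta>
    proof -
      define z where "z = x + \<delta> *\<^sub>R h"
      have "z \<in> interior Q" unfolding z_def h_def using \<delta> by (intro interior_shrink Q x p) auto
      then have low: "d z + gd z (w - z) + 1/2 * (norm (w - z))\<^sup>2 \<le> d w" if "w \<in> Q" for w
        using prox that unfolding prox_function_def by blast
      have xz: "x - z = (- \<delta>) *\<^sub>R h" and pz: "p - z = (1 - \<delta>) *\<^sub>R h"
        by (simp_all add: z_def h_def algebra_simps)
      have "d z - \<delta> * gd z h + 1/2 * (\<delta> * norm h)\<^sup>2 \<le> d x"
        using low[OF x] \<delta> unfolding xz by (simp add: blinfun.scaleR_right blinfun.minus_right)
      then have 1: "(1 - \<delta>) * (d z - \<delta> * gd z h + 1/2 * (\<delta> * norm h)\<^sup>2) \<le> (1 - \<delta>) * d x"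
        using \<delta> by (intro mult_left_mono) auto
      have "d z + (1 - \<delta>) * gd z h + 1/2 * ((1 - \<delta>) * norm h)\<^sup>2 \<le> d p"
        using low[OF pQ] \<delta> unfolding pz by (simp add: blinfun.scaleR_right)
      then have 2: "\<delta> * (d z + (1 - \<delta>) * gd z h + 1/2 * ((1 - \<delta>) * norm h)\<^sup>2) \<le> \<delta> * d p"
        using \<delta> by (intro mult_left_mono) auto
      have "(1 - \<delta>) * (d z - \<delta> * gd z h + 1/2 * (\<delta> * norm h)\<^sup>2)
          + \<delta> * (d z + (1 - \<delta>) * gd z h + 1/2 * ((1 - \<delta>) * norm h)\<^sup>2)
          = d z + \<delta> * (1/2 * (1 - \<delta>) * (norm h)\<^sup>2)"
        by (simp add: power2_eq_square field_simps)
      then have "d z + \<delta> * (1/2 * (1 - \<delta>) * (norm h)\<^sup>2) \<le> (1 - \<delta>) * d x + \<delta> * d p"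
        using 1 2 by linarith
      then have "d z - d x \<le> \<delta> * (d p - d x - 1/2 * (1 - \<delta>) * (norm h)\<^sup>2)"
        by (simp add: algebra_simps)
      then show ?thesis using \<delta> by (simp add: z_def divide_le_eq mult.commute)
    qed
    have "(d has_derivative blinfun_apply (gd x)) (at x within Q)"
      using prox x by (auto simp: prox_function_def)
    from directional_derivative[OF Q x pQ this]
    have lim: "((\<lambda>\<delta>. (d (x + \<delta> *\<^sub>R h) - d x) / \<delta>) \<longlongrightarrow> gd x h) (at_right 0)" by (simp add: h_def)
    have "((\<lambda>\<delta>. d p - d x - 1/2 * (1 - \<delta>) * (norm h)\<^sup>2)
        \<longlongrightarrow> d p - d x - 1/2 * (1 - 0) * (norm h)\<^sup>2) (at_right 0)" by (intro tendsto_intros)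
    moreover have "\<forall>\<^sub>F \<delta> in at_right 0.
        (d (x + \<delta> *\<^sub>R h) - d x) / \<delta> \<le> d p - d x - 1/2 * (1 - \<delta>) * (norm h)\<^sup>2"
      using eventually_at_right_real[of 0 1] by (rule eventually_mono) (use quot in auto)
    ultimately have "gd x h \<le> d p - d x - 1/2 * (1 - 0) * (norm h)\<^sup>2"
      using lim by (intro tendsto_le[OF trivial_limit_at_right_real])
    then show ?thesis by (simp add: h_def)
  qed
  obtain p where p: "p \<in> interior Q" using int by auto
  then have pQ: "p \<in> Q" using interior_subset by blast
  define w where "w = (\<lambda>\<eta>::real. y + \<eta> *\<^sub>R (p - y))"
  have "d x + blinfun_apply (gd x) (w \<eta> - x) + 1/2 * (norm (w \<eta> - x))\<^sup>2 \<le> (1 - \<eta>) * d y + \<eta> * d p"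
    if \<eta>: "0 < \<eta>" "\<eta> < 1" for \<eta>
  proof -
    have "w \<eta> \<in> interior Q" unfolding w_def using \<eta> by (intro interior_shrink Q y p) auto
    note to_interior[OF this]
    also have "d (w \<eta>) = d ((1 - \<eta>) *\<^sub>R y + \<eta> *\<^sub>R p)" by (simp add: w_def algebra_simps)
    also have "\<dots> \<le> (1 - \<eta>) * d y + \<eta> * d p" using \<eta> by (intro convex_onD[OF cvx] y pQ) auto
    finally show ?thesis .
  qed
  then have "\<forall>\<^sub>F \<eta> in at_right 0.
      d x + blinfun_apply (gd x) (w \<eta> - x) + 1/2 * (norm (w \<eta> - x))\<^sup>2 \<le> (1 - \<eta>) * d y + \<eta> * d p"
    using eventually_at_right_real[of 0 1] by (auto elim: eventually_mono)
  moreover have "((\<lambda>\<eta>. (1 - \<eta>) * d y + \<eta> * d p) \<longlongrightarrow> (1 - 0) * d y + 0 * d p) (at_right 0)"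
    by (intro tendsto_intros)
  moreover have "((\<lambda>\<eta>. d x + blinfun_apply (gd x) (w \<eta> - x) + 1/2 * (norm (w \<eta> - x))\<^sup>2)
      \<longlongrightarrow> d x + blinfun_apply (gd x) (y + 0 *\<^sub>R (p - y) - x) + 1/2 * (norm (y + 0 *\<^sub>R (p - y) - x))\<^sup>2)
      (at_right 0)"
    unfolding w_def by (intro tendsto_intros)
  ultimately have "d x + blinfun_apply (gd x) (y + 0 *\<^sub>R (p - y) - x)
      + 1/2 * (norm (y + 0 *\<^sub>R (p - y) - x))\<^sup>2 \<le> (1 - 0) * d y + 0 * d p"
    by (intro tendsto_le[OF trivial_limit_at_right_real])
  then show ?thesis by (simp add: bregman_def)
qed

lemma bregman_nonneg:
  assumes "prox_function Q d gd" "interior Q \<noteq> {}" "x \<in> Q" "y \<in> Q"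
  shows "0 \<le> bregman d gd x y"
  using prox_strong_convexity[OF assms] by (rule order_trans[rotated]) simp

lemma prox_midpoint:
  fixes Q :: "'a::real_normed_vector set"
  assumes prox: "prox_function Q d gd" and int: "interior Q \<noteq> {}" and u: "u \<in> Q" and v: "v \<in> Q"
  shows "d ((1/2) *\<^sub>R u + (1/2) *\<^sub>R v) \<le> 1/2 * d u + 1/2 * d v - 1/8 * (norm (u - v))\<^sup>2"
proof -
  define m where "m = (1/2) *\<^sub>R u + (1/2) *\<^sub>R v"
  have "convex Q" using prox by (auto simp: prox_function_def convex_on_def)
  then have m: "m \<in> Q" unfolding m_def using u v by (intro convexD) auto
  have um: "u - m = (1/2) *\<^sub>R (u - v)" and vm: "v - m = - ((1/2) *\<^sub>R (u - v))"
    by (simp_all add: m_def algebra_simps flip: scaleR_left_distrib)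
  show ?thesis
    using prox_strong_convexity[OF prox int m u] prox_strong_convexity[OF prox int m v]
    unfolding bregman_def um vm
    by (simp add: blinfun.minus_right power_divide m_def[symmetric])
qed

text \<open>Moving from the minimizer \<open>y\<close> a fraction \<open>\<delta>\<close> towards \<open>z\<close> changes \<open>A\<close> by at most
  \<open>\<delta> * (A z - A y)\<close>; minimality and \<open>\<delta> \<rightarrow> 0\<close> give
  \<open>A z - A y \<ge> - M * gd y (z - y)\<close>, which is the claim after adding \<open>M * (d z - d y)\<close>.\<close>

lemma three_point:
  fixes Q :: "'a::real_normed_vector set"
  assumes prox: "prox_function Q d gd" and A: "convex_on Q A" and M: "0 < M"
    and y: "is_arg_min (\<lambda>z. A z + M * d z) (\<lambda>z. z \<in> Q) y" and z: "z \<in> Q"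
  shows "A y + M * d y + M * bregman d gd y z \<le> A z + M * d z"
proof -
  have Q: "convex Q" using A by (simp add: convex_on_def)
  have yQ: "y \<in> Q" and least: "\<And>w. w \<in> Q \<Longrightarrow> A y + M * d y \<le> A w + M * d w"
    using y by (auto simp: is_arg_min_linorder)
  have "(d has_derivative blinfun_apply (gd y)) (at y within Q)"
    using prox yQ by (auto simp: prox_function_def)
  from directional_derivative[OF Q yQ z this]
  have lim: "((\<lambda>\<delta>. (d (y + \<delta> *\<^sub>R (z - y)) - d y) / \<delta>) \<longlongrightarrow> gd y (z - y)) (at_right 0)" .
  have "(A y - A z) / M \<le> (d (y + \<delta> *\<^sub>R (z - y)) - d y) / \<delta>" if \<delta>: "0 < \<delta>" "\<delta> < 1" for \<delta>
  proof -
    define w where "w = (1 - \<delta>) *\<^sub>R y + \<delta> *\<^sub>R z"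
    have "w \<in> Q" unfolding w_def using \<delta> Q yQ z by (intro convexD) auto
    then have "A y + M * d y \<le> A w + M * d w" by (rule least)
    moreover have "A w \<le> (1 - \<delta>) * A y + \<delta> * A z"
      unfolding w_def using \<delta> by (intro convex_onD[OF A] yQ z) auto
    ultimately have "\<delta> * (A y - A z) \<le> M * (d w - d y)" by (simp add: algebra_simps)
    moreover have "w = y + \<delta> *\<^sub>R (z - y)" by (simp add: w_def algebra_simps)
    ultimately show ?thesis using \<delta> M by (simp add: field_simps)
  qed
  then have "\<forall>\<^sub>F \<delta> in at_right 0. (A y - A z) / M \<le> (d (y + \<delta> *\<^sub>R (z - y)) - d y) / \<delta>"
    using eventually_at_right_real[of 0 1] by (auto elim: eventually_mono)
  then have "(A y - A z) / M \<le> gd y (z - y)"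
    by (rule tendsto_lowerbound[OF lim]) simp
  then show ?thesis using M by (simp add: bregman_def field_simps)
qed

section \<open>Existence of the minimizers\<close>

text \<open>Finite dimension enters only through completeness. A vector \<open>b\<close> outside the closed subspace
  \<open>span B\<close> has a positive distance \<open>r\<close> from it, so the coefficient of \<open>b\<close> in a vector is bounded by
  its norm divided by \<open>r\<close>, and a Cauchy sequence splits into two.\<close>

lemma complete_span:
  fixes B :: "'a::real_normed_vector set"
  assumes "finite B" shows "complete (span B)"
  using assms
proof (induction B rule: finite_induct)
  case empty
  then show ?case by (simp add: compact_imp_complete)
next
  case (insert b B)
  show ?case
  proof (cases "b \<in> span B")
    case True
    then show ?thesis using insert.IH by (simp add: span_redundant)
  next
    case False
    have "closed (span B)" by (rule complete_imp_closed[OF insert.IH])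
    then have "open (- span B)" by (rule open_Compl)
    then obtain r where r: "0 < r" "ball b r \<subseteq> - span B"
      using False open_contains_ball by blast
    have lower: "\<bar>c\<bar> * r \<le> norm (v + c *\<^sub>R b)" if v: "v \<in> span B" for v c
    proof (cases "c = 0")
      case False
      have "(- 1 / c) *\<^sub>R v \<in> span B" using v by (rule span_scale)
      then have "r \<le> dist b ((- 1 / c) *\<^sub>R v)" using r(2) by (metis ComplD leI mem_ball subsetD)
      also have "\<dots> = norm (v + c *\<^sub>R b) / \<bar>c\<bar>"
      proof -
        have "b - (- 1 / c) *\<^sub>R v = (1 / c) *\<^sub>R (v + c *\<^sub>R b)" using False by (simp add: algebra_simps)
        then show ?thesis by (simp add: dist_norm divide_inverse mult.commute)
      qed
      finally show ?thesis using False by (simp add: field_simps)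
    qed simp
    show ?thesis unfolding complete_def
    proof (intro allI impI, elim conjE)
      fix x :: "nat \<Rightarrow> 'a" assume x: "\<forall>n. x n \<in> span (insert b B)" and "Cauchy x"
      have "\<exists>k. x n - k *\<^sub>R b \<in> span B" for n using x span_breakdown_eq by blast
      then obtain c where c: "\<And>n. x n - c n *\<^sub>R b \<in> span B" by metis
      define v where "v = (\<lambda>n. x n - c n *\<^sub>R b)"
      have "Cauchy c"
      proof (rule metric_CauchyI)
        fix e :: real assume "0 < e"
        then obtain N where N: "\<And>m n. N \<le> m \<Longrightarrow> N \<le> n \<Longrightarrow> dist (x m) (x n) < e * r"
          using \<open>Cauchy x\<close> r metric_CauchyD[of x "e * r"] by auto
        have "dist (c m) (c n) < e" if "N \<le> m" "N \<le> n" for m n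
        proof -
          have "\<bar>c m - c n\<bar> * r \<le> norm ((v m - v n) + (c m - c n) *\<^sub>R b)"
            by (intro lower span_diff) (simp_all add: v_def c)
          also have "\<dots> = dist (x m) (x n)" by (simp add: v_def dist_norm algebra_simps)
          also have "\<dots> < e * r" using N that by simp
          finally show ?thesis using r by (simp add: dist_real_def)
        qed
        then show "\<exists>M. \<forall>m\<ge>M. \<forall>n\<ge>M. dist (c m) (c n) < e" by blast
      qed
      then obtain c' where c': "c \<longlonglongrightarrow> c'" by (auto simp: Cauchy_convergent_iff convergent_def)
      have cb: "Cauchy (\<lambda>n. c n *\<^sub>R b)"
        by (intro LIMSEQ_imp_Cauchy[of _ "c' *\<^sub>R b"] tendsto_intros c')
      have "Cauchy v"
      proof (rule metric_CauchyI)
        fix e :: real assume "0 < e"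
        then have "0 < e / 2" by simp
        obtain N1 where N1: "\<And>m n. N1 \<le> m \<Longrightarrow> N1 \<le> n \<Longrightarrow> dist (x m) (x n) < e / 2"
          using metric_CauchyD[OF \<open>Cauchy x\<close> \<open>0 < e / 2\<close>] by auto
        obtain N2 where N2: "\<And>m n. N2 \<le> m \<Longrightarrow> N2 \<le> n \<Longrightarrow> dist (c m *\<^sub>R b) (c n *\<^sub>R b) < e / 2"
          using metric_CauchyD[OF cb \<open>0 < e / 2\<close>] by auto
        have "dist (v m) (v n) < e" if "max N1 N2 \<le> m" "max N1 N2 \<le> n" for m n
        proof -
          have "dist (v m) (v n) \<le> dist (x m) (x n) + dist (c m *\<^sub>R b) (c n *\<^sub>R b)"
            unfolding v_def dist_norm using norm_triangle_ineq4[of "x m - x n" "c m *\<^sub>R b - c n *\<^sub>R b"]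
            by (simp add: algebra_simps)
          then show ?thesis using N1[of m n] N2[of m n] that by simp
        qed
        then show "\<exists>M. \<forall>m\<ge>M. \<forall>n\<ge>M. dist (v m) (v n) < e" by blast
      qed
      moreover have "\<forall>n. v n \<in> span B" by (simp add: v_def c)
      ultimately obtain v' where v': "v' \<in> span B" "v \<longlonglongrightarrow> v'"
        using insert.IH unfolding complete_def by blast
      have "(\<lambda>n. v n + c n *\<^sub>R b) \<longlonglongrightarrow> v' + c' *\<^sub>R b" by (intro tendsto_intros v' c')
      then have "x \<longlonglongrightarrow> v' + c' *\<^sub>R b" by (simp add: v_def)
      moreover have "v' \<in> span (insert b B)" "b \<in> span (insert b B)"
        using v'(1) span_mono[OF subset_insertI, of B b] by (auto intro: span_base)
      then have "v' + c' *\<^sub>R b \<in> span (insert b B)" by (intro span_add span_scale)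
      ultimately show "\<exists>l\<in>span (insert b B). x \<longlonglongrightarrow> l" by blast
    qed
  qed
qed

text \<open>If \<open>\<Psi>\<close> fell faster than every multiple of the distance to \<open>p\<close>, the segments from \<open>p\<close> to points
  of the epigraph far below would become vertical: moving along each of them until the height has
  dropped by about one, one stays near \<open>p\<close>, and by closedness \<open>(p, \<Psi> p - 1)\<close> would belong to the
  epigraph.\<close>

lemma closed_convex_lower_growth:
  fixes Q :: "'a::real_normed_vector set"
  assumes cvx: "convex_on Q \<Psi>" and closed: "closed (epigraph Q \<Psi>)" and p: "p \<in> Q"
  obtains C where "\<And>y. y \<in> Q \<Longrightarrow> - (C * (1 + norm (y - p))) \<le> \<Psi> y"
proof -
  have "\<exists>C. \<forall>y\<in>Q. - (C * (1 + norm (y - p))) \<le> \<Psi> y"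
  proof (rule ccontr)
    assume "\<not> ?thesis"
    then have "\<forall>n::nat. \<exists>y\<in>Q. \<Psi> y < - (real (Suc n) * (1 + norm (y - p)))" by (meson not_le)
    then obtain y where y: "\<And>n::nat. y n \<in> Q"
      "\<And>n::nat. \<Psi> (y n) < - (real (Suc n) * (1 + norm (y n - p)))" by metis
    (* 1 / l n is the fraction of the segment on which the height drops by about one *)
    define l where "l = (\<lambda>n. - \<Psi> (y n))"
    have l: "real (Suc n) * (1 + norm (y n - p)) < l n" for n using y(2)[of n] unfolding l_def by linarith
    have l1: "real (Suc n) \<le> l n" for n
    proof -
      have "real (Suc n) \<le> real (Suc n) * (1 + norm (y n - p))"
        using mult_left_mono[of 1 "1 + norm (y n - p)" "real (Suc n)"] by simp
      then show ?thesis using l[of n] by (meson less_imp_le order.trans)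
    qed
    have linv: "1 / l n \<le> inverse (real (Suc n))" for n
      using l1[of n] by (simp add: divide_inverse le_imp_inverse_le)
    have "(\<lambda>n. 1 / l n) \<longlonglongrightarrow> 0"
    proof (rule tendsto_sandwich[OF _ _ tendsto_const LIMSEQ_inverse_real_of_nat])
      show "\<forall>\<^sub>F n in sequentially. 0 \<le> 1 / l n"
        using l1 by (intro always_eventually allI) (smt (verit) of_nat_0_le_iff zero_le_divide_1_iff)
      show "\<forall>\<^sub>F n in sequentially. 1 / l n \<le> inverse (real (Suc n))" using linv by simp
    qed
    note l0 = this
    have y0: "(\<lambda>n. (1 / l n) *\<^sub>R (y n - p)) \<longlonglongrightarrow> 0"
    proof (rule Lim_null_comparison[OF _ LIMSEQ_inverse_real_of_nat])
      show "\<forall>\<^sub>F n in sequentially. norm ((1 / l n) *\<^sub>R (y n - p)) \<le> inverse (real (Suc n))"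
      proof (intro always_eventually allI)
        fix n
        have pos: "0 < l n" using l1[of n] by linarith
        have "real (Suc n) * norm (y n - p) \<le> real (Suc n) * (1 + norm (y n - p))"
          by (intro mult_left_mono) auto
        then have "real (Suc n) * norm (y n - p) \<le> l n" using l[of n] by linarith
        then have "norm (y n - p) / l n \<le> inverse (real (Suc n))"
          using pos by (simp add: field_simps)
        then show "norm ((1 / l n) *\<^sub>R (y n - p)) \<le> inverse (real (Suc n))"
          using pos unfolding norm_scaleR by simp
      qed
    qed
    have mem: "(p + (1 / l n) *\<^sub>R (y n - p), \<Psi> p + 1 / l n * (\<Psi> (y n) - \<Psi> p)) \<in> epigraph Q \<Psi>" for n
    proof -
      define \<delta> where "\<delta> = 1 / l n"
      have \<delta>: "0 \<le> \<delta>" "\<delta> \<le> 1" using l1[of n] by (auto simp: \<delta>_def)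
      have Q: "convex Q" using cvx by (simp add: convex_on_def)
      have "(1 - \<delta>) *\<^sub>R p + \<delta> *\<^sub>R y n \<in> Q" using \<delta> Q y(1) p by (intro convexD) auto
      moreover have "\<Psi> ((1 - \<delta>) *\<^sub>R p + \<delta> *\<^sub>R y n) \<le> (1 - \<delta>) * \<Psi> p + \<delta> * \<Psi> (y n)"
        using \<delta> by (intro convex_onD[OF cvx] y(1) p)
      ultimately show ?thesis by (simp add: mem_epigraph \<delta>_def algebra_simps)
    qed
    have "1 / l n * (\<Psi> (y n) - \<Psi> p) = - 1 - 1 / l n * \<Psi> p" for n
      using l1[of n] by (simp add: l_def field_simps)
    then have mem': "(p + (1 / l n) *\<^sub>R (y n - p), \<Psi> p + (- 1 - 1 / l n * \<Psi> p)) \<in> epigraph Q \<Psi>" for n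
      using mem[of n] by simp
    have "(\<lambda>n. (p + (1 / l n) *\<^sub>R (y n - p), \<Psi> p + (- 1 - 1 / l n * \<Psi> p)))
        \<longlonglongrightarrow> (p + 0, \<Psi> p + (- 1 - 0 * \<Psi> p))"
      by (intro tendsto_intros l0 y0)
    then have "(p + 0, \<Psi> p + (- 1 - 0 * \<Psi> p)) \<in> epigraph Q \<Psi>"
      by (rule closed_sequentially[OF closed mem'])
    then show False by (simp add: mem_epigraph)
  qed
  then show ?thesis using that by blast
qed

lemma quadratic_absorbs_linear:
  fixes a K r :: real
  assumes "0 < a" shows "- (K\<^sup>2 / (2 * a)) \<le> a / 2 * r\<^sup>2 - K * r"
proof -
  have "a / 2 * r\<^sup>2 - K * r + K\<^sup>2 / (2 * a) = a / 2 * (r - K / a)\<^sup>2"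
    using assms by (simp add: power2_eq_square field_simps)
  moreover have "0 \<le> a / 2 * (r - K / a)\<^sup>2" using assms by simp
  ultimately show ?thesis by linarith
qed

text \<open>All subproblems of both methods have this form. Strong convexity of \<open>d\<close> dominates the at most
  linear decrease of the other terms, so the infimum is finite, and it makes every minimizing
  sequence Cauchy. As \<open>Q\<close> need not be closed, the limit is located through the closed epigraph of
  \<open>\<Psi>\<close>.\<close>

lemma prox_regularized_minimizer:
  fixes Q :: "'a::real_normed_vector set" and g :: "'a \<Rightarrow>\<^sub>L real"
  assumes compl: "complete (UNIV :: 'a set)"
    and cvx: "convex_on Q \<Psi>" and closed: "closed (epigraph Q \<Psi>)"
    and int: "interior Q \<noteq> {}" and prox: "prox_function Q d gd"
    and a: "0 < a" and b: "0 < b"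
  shows "\<exists>y. is_arg_min (\<lambda>z. a * d z + b * \<Psi> z + blinfun_apply g z) (\<lambda>z. z \<in> Q) y"
proof -
  define H where "H = (\<lambda>z. a * d z + b * \<Psi> z + blinfun_apply g z)"
  have Q: "convex Q" using cvx by (simp add: convex_on_def)
  obtain p where p: "p \<in> Q" using int interior_subset by blast
  obtain C where C: "\<And>y. y \<in> Q \<Longrightarrow> - (C * (1 + norm (y - p))) \<le> \<Psi> y"
    using closed_convex_lower_growth[OF cvx closed p] by blast
  define K where "K = a * norm (gd p) + b * C + norm g"
  define L where "L = a * d p - b * C + blinfun_apply g p - K\<^sup>2 / (2 * a)"
  have "L \<le> H y" if y: "y \<in> Q" for y
  proof -
    define r where "r = norm (y - p)"
    have "\<bar>gd p (y - p)\<bar> \<le> norm (gd p) * r" "\<bar>g (y - p)\<bar> \<le> norm g * r"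
      unfolding r_def by (metis norm_blinfun real_norm_def)+
    moreover have "d p + gd p (y - p) + 1/2 * r\<^sup>2 \<le> d y"
      using prox_strong_convexity[OF prox int p y] by (simp add: bregman_def r_def)
    ultimately have "d p - norm (gd p) * r + 1/2 * r\<^sup>2 \<le> d y" "g p - norm g * r \<le> g y"
      by (auto simp: blinfun.diff_right)
    moreover have "- (C * (1 + r)) \<le> \<Psi> y" using C[OF y] by (simp add: r_def)
    ultimately have "a * (d p - norm (gd p) * r + 1/2 * r\<^sup>2) + b * (- (C * (1 + r))) + (g p - norm g * r)
        \<le> H y"
      unfolding H_def using a b by (intro add_mono mult_left_mono) auto
    moreover have "a * (d p - norm (gd p) * r + 1/2 * r\<^sup>2) + b * (- (C * (1 + r))) + (g p - norm g * r)
        = a * d p - b * C + g p + (a / 2 * r\<^sup>2 - K * r)"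
      by (simp add: K_def algebra_simps)
    ultimately show ?thesis using quadratic_absorbs_linear[OF a, of K r] by (simp add: L_def)
  qed
  then have bdd: "bdd_below (H ` Q)" by (rule bdd_belowI2)
  define I where "I = Inf (H ` Q)"
  have I: "I \<le> H y" if "y \<in> Q" for y unfolding I_def using bdd that by (intro cInf_lower) auto
  have "\<exists>y\<in>Q. H y < I + inverse (real (Suc n))" for n
  proof -
    have "I < I + inverse (real (Suc n))" by simp
    then show ?thesis unfolding I_def using cInf_lessD[of "H ` Q"] p by blast
  qed
  then obtain y where y: "\<And>n. y n \<in> Q" "\<And>n. H (y n) < I + inverse (real (Suc n))" by metis
  have gap: "a / 8 * (norm (u - v))\<^sup>2 \<le> (H u + H v) / 2 - I" if u: "u \<in> Q" and v: "v \<in> Q" for u v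
  proof -
    define m where "m = (1/2) *\<^sub>R u + (1/2) *\<^sub>R v"
    have "m \<in> Q" unfolding m_def using Q u v by (intro convexD) auto
    then have "I \<le> H m" by (rule I)
    moreover have "a * d m \<le> a * (1/2 * d u + 1/2 * d v - 1/8 * (norm (u - v))\<^sup>2)"
      unfolding m_def using a by (intro mult_left_mono prox_midpoint[OF prox int u v]) auto
    moreover have "\<Psi> m \<le> 1/2 * \<Psi> u + 1/2 * \<Psi> v"
      using convex_onD[OF cvx _ _ u v, of "1/2"] by (simp add: m_def)
    then have "b * \<Psi> m \<le> b * (1/2 * \<Psi> u + 1/2 * \<Psi> v)" using b by (intro mult_left_mono) auto
    moreover have "g m = 1/2 * g u + 1/2 * g v"
      by (simp add: m_def blinfun.add_right blinfun.scaleR_right)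
    ultimately show ?thesis by (simp add: H_def algebra_simps)
  qed
  have "Cauchy y"
  proof (rule metric_CauchyI)
    fix e :: real assume e: "0 < e"
    then have "0 < a / 8 * e\<^sup>2" using a by simp
    then obtain N where N: "inverse (real (Suc N)) < a / 8 * e\<^sup>2" using reals_Archimedean by blast
    define \<rho> where "\<rho> = inverse (real (Suc N))"
    have "dist (y m) (y n) < e" if mn: "N \<le> m" "N \<le> n" for m n
    proof -
      have small: "inverse (real (Suc j)) \<le> \<rho>" if "N \<le> j" for j
        unfolding \<rho>_def using that by (intro le_imp_inverse_le) auto
      have "a / 8 * (norm (y m - y n))\<^sup>2 \<le> (H (y m) + H (y n)) / 2 - I" by (intro gap y)
      also have "\<dots> \<le> \<rho>"
        using less_le_trans[OF y(2) add_left_mono[OF small[OF mn(1)]]]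
          less_le_trans[OF y(2) add_left_mono[OF small[OF mn(2)]]] by (simp add: field_simps)
      finally have "a / 8 * (norm (y m - y n))\<^sup>2 < a / 8 * e\<^sup>2" using N unfolding \<rho>_def by linarith
      then have "(norm (y m - y n))\<^sup>2 < e\<^sup>2" using a by (simp add: mult_less_cancel_left_pos)
      then show ?thesis using e by (simp add: dist_norm power_less_imp_less_base)
    qed
    then show "\<exists>M. \<forall>m\<ge>M. \<forall>n\<ge>M. dist (y m) (y n) < e" by blast
  qed
  then obtain l where l: "y \<longlonglongrightarrow> l" using compl unfolding complete_def by auto
  have HI: "(\<lambda>n. H (y n)) \<longlonglongrightarrow> I"
  proof (rule tendsto_sandwich[where f = "\<lambda>_. I" and h = "\<lambda>n. I + inverse (real (Suc n))"])
    show "(\<lambda>n. I + inverse (real (Suc n))) \<longlonglongrightarrow> I"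
      using tendsto_add[OF tendsto_const[of I] LIMSEQ_inverse_real_of_nat] by simp
    show "\<forall>\<^sub>F n in sequentially. H (y n) \<le> I + inverse (real (Suc n))"
      using y(2) by (intro always_eventually allI less_imp_le)
    show "\<forall>\<^sub>F n in sequentially. I \<le> H (y n)" using I y(1) by simp
  qed simp
  (* Upper bounds e n of the values of \<Psi> that converge although d is not yet known to be
     continuous at l; they only serve to show that l lies in Q. *)
  define e where "e = (\<lambda>n. (H (y n) - a * (d p + gd p (y n - p)) - g (y n)) / b)"
  have e_lim: "e \<longlonglongrightarrow> (I - a * (d p + gd p (l - p)) - g l) / b"
    unfolding e_def using b by (intro tendsto_intros HI l) auto
  have e_mem: "(y n, e n) \<in> epigraph Q \<Psi>" for n
  proof -
    have "0 \<le> 1/2 * (norm (y n - p))\<^sup>2" by simp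
    then have "d p + gd p (y n - p) \<le> d (y n)"
      using prox_strong_convexity[OF prox int p y(1)[of n]] unfolding bregman_def by linarith
    then have "a * (d p + gd p (y n - p)) \<le> a * d (y n)" using a by (intro mult_left_mono) auto
    then have "\<Psi> (y n) \<le> e n" using b by (simp add: e_def H_def field_simps)
    then show ?thesis using y(1) by (simp add: mem_epigraph)
  qed
  have "(l, (I - a * (d p + gd p (l - p)) - g l) / b) \<in> epigraph Q \<Psi>"
    by (rule closed_sequentially[OF closed e_mem tendsto_Pair[OF l e_lim]])
  then have lQ: "l \<in> Q" by (simp add: mem_epigraph)
  then have "(d has_derivative gd l) (at l within Q)" using prox by (auto simp: prox_function_def)
  then have "continuous (at l within Q) d" by (rule has_derivative_continuous)
  then have dl: "(\<lambda>n. d (y n)) \<longlonglongrightarrow> d l"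
    using l y(1) by (auto simp: continuous_within_sequentially o_def)
  have "(\<lambda>n. (H (y n) - a * d (y n) - g (y n)) / b) \<longlonglongrightarrow> (I - a * d l - g l) / b"
    using b by (intro tendsto_intros HI dl l) auto
  moreover have "(H (y n) - a * d (y n) - g (y n)) / b = \<Psi> (y n)" for n
    using b by (simp add: H_def)
  ultimately have \<Psi>_lim: "(\<lambda>n. \<Psi> (y n)) \<longlonglongrightarrow> (I - a * d l - g l) / b" by simp
  have y_mem: "(y n, \<Psi> (y n)) \<in> epigraph Q \<Psi>" for n using y(1) by (simp add: mem_epigraph)
  have "(l, (I - a * d l - g l) / b) \<in> epigraph Q \<Psi>"
    by (rule closed_sequentially[OF closed y_mem tendsto_Pair[OF l \<Psi>_lim]])
  then have "l \<in> Q \<and> H l \<le> I" using b by (simp add: mem_epigraph H_def field_simps)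
  then show ?thesis unfolding is_arg_min_linorder H_def[symmetric] using I by (meson order_trans)
qed

section \<open>Convergence of the two methods\<close>

lemma is_arg_min_arg_min_on:
  assumes "\<exists>y. is_arg_min h (\<lambda>z. z \<in> Q) y"
  shows "is_arg_min h (\<lambda>z. z \<in> Q) (arg_min_on h Q)"
  unfolding arg_min_on_def arg_min_def using assms by (rule someI_ex)

lemma convex_on_blinfun:
  fixes g :: "'a::real_normed_vector \<Rightarrow>\<^sub>L real"
  assumes "convex Q" shows "convex_on Q (blinfun_apply g)"
  using assms by (simp add: convex_on_def blinfun.add_right blinfun.scaleR_right)

lemma convex_on_composite_linearization:
  fixes f :: "'a::real_normed_vector \<Rightarrow> real"
  assumes "convex_on Q \<Psi>" shows "convex_on Q (composite_linearization f gf \<Psi> x)"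
proof -
  have "convex Q" using assms by (simp add: convex_on_def)
  then have "convex_on Q (\<lambda>y. blinfun_apply (gf x) y + \<Psi> y + (f x - blinfun_apply (gf x) x))"
    by (intro convex_on_add convex_on_blinfun convex_on_const[THEN iffD2] assms)
  then show ?thesis
    by (simp add: composite_linearization_def[abs_def] blinfun.diff_right algebra_simps)
qed

lemma composite_linearization_le:
  assumes "subgradient_selection f gf"
  shows "composite_linearization f gf \<Psi> x z \<le> f z + \<Psi> z"
  using assms by (simp add: subgradient_selection_def composite_linearization_def)

lemma bregman_map_minimizes:
  fixes Q :: "'a::real_normed_vector set"
  assumes compl: "complete (UNIV :: 'a set)"
    and cvx: "convex_on Q \<Psi>" and closed: "closed (epigraph Q \<Psi>)"
    and int: "interior Q \<noteq> {}" and prox: "prox_function Q d gd" and M: "0 < M"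
  shows "is_arg_min (bregman_model f gf \<Psi> d gd M x) (\<lambda>z. z \<in> Q) (bregman_map f gf Q \<Psi> d gd M x)"
proof -
  define c where "c = f x - gf x x - M * d x + M * gd x x"
  obtain y where "is_arg_min (\<lambda>z. M * d z + 1 * \<Psi> z + blinfun_apply (gf x - M *\<^sub>R gd x) z) (\<lambda>z. z \<in> Q) y"
    using prox_regularized_minimizer[OF compl cvx closed int prox M] by (metis zero_less_one)
  moreover have "bregman_model f gf \<Psi> d gd M x z
      = (M * d z + 1 * \<Psi> z + blinfun_apply (gf x - M *\<^sub>R gd x) z) + c" for z
    by (simp add: bregman_model_def composite_linearization_def bregman_def c_def
        blinfun.diff_right blinfun.diff_left blinfun.scaleR_left algebra_simps)
  ultimately have "is_arg_min (bregman_model f gf \<Psi> d gd M x) (\<lambda>z. z \<in> Q) y"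
    by (simp add: is_arg_min_linorder)
  then show ?thesis unfolding bregman_map_def by (intro is_arg_min_arg_min_on exI)
qed

text \<open>Up to a constant, the estimating function falls under the scheme for which a minimizer exists.\<close>

lemma dgm_phi_prox_form:
  fixes f :: "'a::real_normed_vector \<Rightarrow> real"
  shows "\<exists>g c. \<forall>z. dgm_phi f gf \<Psi> d gd x0 x L k z
    = d z + (\<Sum>i<k. 1 / (2 * L (Suc i))) * \<Psi> z + blinfun_apply g z + c"
proof (induction k)
  case 0
  have "dgm_phi f gf \<Psi> d gd x0 x L 0 z = d z + (\<Sum>i<0. 1 / (2 * L (Suc i))) * \<Psi> z
      + blinfun_apply (- gd x0) z + (gd x0 x0 - d x0)" for z
    by (simp add: bregman_def blinfun.diff_right blinfun.minus_left)
  then show ?case by blast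
next
  case (Suc k)
  then obtain g c where gc: "\<And>z. dgm_phi f gf \<Psi> d gd x0 x L k z
    = d z + (\<Sum>i<k. 1 / (2 * L (Suc i))) * \<Psi> z + blinfun_apply g z + c" by blast
  define w where "w = 1 / (2 * L (Suc k))"
  have "dgm_phi f gf \<Psi> d gd x0 x L (Suc k) z
    = d z + (\<Sum>i<Suc k. 1 / (2 * L (Suc i))) * \<Psi> z + blinfun_apply (g + w *\<^sub>R gf (x k)) z
      + (c + w * (f (x k) - gf (x k) (x k)))" for z
  proof -
    have "dgm_phi f gf \<Psi> d gd x0 x L (Suc k) z
      = dgm_phi f gf \<Psi> d gd x0 x L k z + w * composite_linearization f gf \<Psi> (x k) z"
      by (simp add: w_def)
    moreover have "(\<Sum>i<Suc k. 1 / (2 * L (Suc i))) = (\<Sum>i<k. 1 / (2 * L (Suc i))) + w"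
      by (simp add: w_def)
    ultimately show ?thesis unfolding gc
      by (simp only: composite_linearization_def blinfun.diff_right
          blinfun.add_left blinfun.scaleR_left) (simp add: algebra_simps)
  qed
  then show ?case by blast
qed

lemma dgm_trial_minimizes:
  fixes Q :: "'a::real_normed_vector set"
  assumes compl: "complete (UNIV :: 'a set)"
    and cvx: "convex_on Q \<Psi>" and closed: "closed (epigraph Q \<Psi>)"
    and int: "interior Q \<noteq> {}" and prox: "prox_function Q d gd"
    and L: "\<And>i. i \<le> k \<Longrightarrow> 0 < L (Suc i)"
  shows "is_arg_min (dgm_phi f gf \<Psi> d gd x0 x L (Suc k)) (\<lambda>z. z \<in> Q)
    (dgm_trial f gf Q \<Psi> (dgm_phi f gf \<Psi> d gd x0 x L k) (2 * L (Suc k)) (x k))"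
proof -
  define b where "b = (\<Sum>i<Suc k. 1 / (2 * L (Suc i)))"
  have b: "0 < b" unfolding b_def using L by (intro sum_pos) auto
  obtain g c where gc: "\<And>z. dgm_phi f gf \<Psi> d gd x0 x L (Suc k) z = 1 * d z + b * \<Psi> z + blinfun_apply g z + c"
    using dgm_phi_prox_form[of f gf \<Psi> d gd x0 x L "Suc k"] unfolding b_def by auto
  obtain y where "is_arg_min (\<lambda>z. 1 * d z + b * \<Psi> z + blinfun_apply g z) (\<lambda>z. z \<in> Q) y"
    using prox_regularized_minimizer[OF compl cvx closed int prox zero_less_one b] by metis
  then have "is_arg_min (dgm_phi f gf \<Psi> d gd x0 x L (Suc k)) (\<lambda>z. z \<in> Q) y"
    using gc by (simp add: is_arg_min_linorder del: dgm_phi.simps)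
  then have "is_arg_min (dgm_phi f gf \<Psi> d gd x0 x L (Suc k)) (\<lambda>z. z \<in> Q)
      (arg_min_on (dgm_phi f gf \<Psi> d gd x0 x L (Suc k)) Q)"
    by (intro is_arg_min_arg_min_on exI)
  then show ?thesis by (simp add: dgm_trial_def)
qed

lemma dgm_phi_three_point:
  fixes Q :: "'a::real_normed_vector set"
  assumes cvx: "convex_on Q \<Psi>" and prox: "prox_function Q d gd"
    and L: "\<And>i. i < k \<Longrightarrow> 0 < L (Suc i)"
    and y: "is_arg_min (dgm_phi f gf \<Psi> d gd x0 x L k) (\<lambda>z. z \<in> Q) y" and z: "z \<in> Q"
  shows "dgm_phi f gf \<Psi> d gd x0 x L k y + bregman d gd y z \<le> dgm_phi f gf \<Psi> d gd x0 x L k z"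
proof -
  define b where "b = (\<Sum>i<k. 1 / (2 * L (Suc i)))"
  have b: "0 \<le> b" unfolding b_def using L by (intro sum_nonneg) (simp add: less_imp_le)
  obtain g c where gc: "\<And>z. dgm_phi f gf \<Psi> d gd x0 x L k z = d z + b * \<Psi> z + blinfun_apply g z + c"
    using dgm_phi_prox_form[of f gf \<Psi> d gd x0 x L k] unfolding b_def by auto
  define A where "A = (\<lambda>z. b * \<Psi> z + blinfun_apply g z + c)"
  have "convex Q" using cvx by (simp add: convex_on_def)
  then have "convex_on Q A" unfolding A_def using cvx b
    by (intro convex_on_add convex_on_cmul convex_on_blinfun convex_on_const[THEN iffD2])
  moreover have phi: "dgm_phi f gf \<Psi> d gd x0 x L k z = A z + 1 * d z" for z by (simp add: gc A_def)
  ultimately show ?thesis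
    using three_point[OF prox, of A 1 y z] y z by (simp add: is_arg_min_linorder)
qed

text \<open>Either the trial constant is accepted at once and halved, or the last rejected trial, which is
  below \<open>\<gamma>\<close>, is kept.\<close>

lemma line_search_bound:
  fixes L :: "nat \<Rightarrow> real"
  assumes accept: "\<And>j M. j < n \<Longrightarrow> \<gamma> \<le> M \<Longrightarrow> P j M"
    and reject: "\<And>j m. j < n \<Longrightarrow> m < i j \<Longrightarrow> \<not> P j (2 ^ m * L j)"
    and step: "\<And>j. j < n \<Longrightarrow> L (Suc j) = 2 ^ i j * L j / 2"
    and L0: "0 < L 0" "L 0 \<le> \<gamma>" and j: "j \<le> n"
  shows "0 < L j \<and> L j \<le> \<gamma>"
  using j
proof (induction j)
  case 0
  then show ?case using L0 by simp
next
  case (Suc j)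
  then have j: "j < n" and Lj: "0 < L j" "L j \<le> \<gamma>" by auto
  have "L (Suc j) \<le> \<gamma>"
  proof (cases "i j")
    case 0
    then show ?thesis using step[OF j] Lj by simp
  next
    case (Suc m)
    then have "\<not> \<gamma> \<le> 2 ^ m * L j" using accept[OF j] reject[OF j, of m] by auto
    then show ?thesis using step[OF j] Suc by simp
  qed
  moreover have "0 < L (Suc j)" unfolding step[OF j] using Lj by simp
  ultimately show ?case by simp
qed

text \<open>Summed inequalities of both methods have the shape of the last premise. Since every \<open>L\<close> is at
  most \<open>\<gamma>\<close>, the total weight \<open>S\<close> is at least \<open>k / \<gamma>\<close>, so the term \<open>2 * D / S\<close> is at most \<open>\<epsilon> / 2\<close>;
  the other half of \<open>\<epsilon>\<close> is the line-search tolerance.\<close>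

lemma averaged_value_gap:
  fixes L :: "nat \<Rightarrow> real"
  assumes k: "1 \<le> k" and L: "\<And>j. j < k \<Longrightarrow> 0 < L (Suc j) \<and> L (Suc j) \<le> \<gamma>"
    and D: "0 \<le> D" and k_ge: "4 / \<epsilon> * \<gamma> * D \<le> real k" and e: "0 < \<epsilon>"
    and total: "(\<Sum>j<k. 1 / (2 * L (Suc j)) * (F (z j) - Fs - \<epsilon> / 2)) \<le> D"
  shows "averaged_value F L k z - Fs \<le> \<epsilon>"
proof -
  define S where "S = (\<Sum>j<k. 1 / L (Suc j))"
  have \<gamma>: "0 < \<gamma>" using L[of 0] k by auto
  have "(\<Sum>j<k. 1 / \<gamma>) \<le> S" unfolding S_def
    using L by (intro sum_mono) (simp add: frac_le)
  then have S: "real k / \<gamma> \<le> S" by simp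
  moreover have "0 < real k / \<gamma>" using k \<gamma> by simp
  ultimately have S0: "0 < S" by linarith
  have "4 * D / \<epsilon> \<le> real k / \<gamma>" using k_ge \<gamma> e by (simp add: field_simps)
  then have "4 * D / \<epsilon> \<le> S" using S by linarith
  then have DS: "2 * D \<le> \<epsilon> / 2 * S" using e by (simp add: field_simps)
  define T where "T = (\<Sum>j<k. 1 / L (Suc j) * F (z j))"
  have "(\<Sum>j<k. 1 / (2 * L (Suc j)) * (F (z j) - Fs - \<epsilon> / 2))
      = (\<Sum>j<k. 1/2 * (1 / L (Suc j) * F (z j)) - (Fs + \<epsilon> / 2) / 2 * (1 / L (Suc j)))"
  proof (intro sum.cong refl)
    fix j assume "j \<in> {..<k}"
    then have "L (Suc j) \<noteq> 0" using L[of j] by auto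
    then show "1 / (2 * L (Suc j)) * (F (z j) - Fs - \<epsilon> / 2)
        = 1/2 * (1 / L (Suc j) * F (z j)) - (Fs + \<epsilon> / 2) / 2 * (1 / L (Suc j))"
      by (simp add: field_simps)
  qed
  also have "\<dots> = 1/2 * T - (Fs + \<epsilon> / 2) / 2 * S"
    unfolding T_def S_def by (simp only: sum_subtractf sum_distrib_left)
  finally have "1/2 * T \<le> D + (Fs + \<epsilon> / 2) / 2 * S" using total by linarith
  then have "T \<le> (Fs + \<epsilon>) * S" using DS by (simp add: field_simps)
  moreover have "averaged_value F L k z = T / S" by (simp add: averaged_value_def T_def S_def)
  moreover have "T / S \<le> Fs + \<epsilon>" using calculation(1) S0 by (simp add: divide_le_eq)
  ultimately show ?thesis by linarith
qed

lemma pgm_accepts_large: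
  fixes f :: "'a::real_normed_vector \<Rightarrow> real"
  assumes "regularity f" "convex_on UNIV f" "subgradient_selection f gf"
    and "\<not> (\<exists>(g :: 'a \<Rightarrow>\<^sub>L real) c. \<forall>x. f x = blinfun_apply g x + c)"
    and "0 < \<epsilon>" "gamma_gauge f \<epsilon> \<le> M"
  shows "pgm_accepts f gf Q \<Psi> d gd \<epsilon> x M"
  unfolding pgm_accepts_def Let_def by (rule gamma_gauge_upper_model[OF assms])

text \<open>The Bregman distance is at least half the squared norm, so the primal test is the stricter one.
  Through it the line search of the dual method inherits its bound, and an accepted primal step also
  satisfies the model inequality of the dual method.\<close>

lemma pgm_accepts_imp_dgm_accepts:
  fixes Q :: "'a::real_normed_vector set"
  assumes prox: "prox_function Q d gd" and int: "interior Q \<noteq> {}" and x: "x \<in> Q"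
    and y: "bregman_map f gf Q \<Psi> d gd M x \<in> Q" and M: "0 \<le> M"
    and acc: "pgm_accepts f gf Q \<Psi> d gd \<epsilon> x M"
  shows "dgm_accepts f gf Q \<Psi> d gd \<epsilon> x M"
proof -
  define w where "w = bregman_map f gf Q \<Psi> d gd M x"
  have "M * (1/2 * (norm (w - x))\<^sup>2) \<le> M * bregman d gd x w"
    using prox_strong_convexity[OF prox int x y] M by (intro mult_left_mono) (auto simp: w_def)
  then show ?thesis
    using acc unfolding dgm_accepts_def pgm_accepts_def bregman_model_def composite_linearization_def
    by (simp add: Let_def w_def[symmetric])
qed

lemma pgm_step:
  fixes Q :: "'a::real_normed_vector set"
  assumes prox: "prox_function Q d gd" and sub: "subgradient_selection f gf"
    and cvx: "convex_on Q \<Psi>" and M: "0 < M"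
    and y: "is_arg_min (bregman_model f gf \<Psi> d gd M x) (\<lambda>z. z \<in> Q) y" and z: "z \<in> Q"
    and acc: "f y + \<Psi> y \<le> bregman_model f gf \<Psi> d gd M x y + \<epsilon> / 2"
  shows "1 / M * (f y + \<Psi> y - (f z + \<Psi> z) - \<epsilon> / 2) \<le> bregman d gd x z - bregman d gd y z"
proof -
  define A where "A = (\<lambda>z. composite_linearization f gf \<Psi> x z
    + (blinfun_apply ((- M) *\<^sub>R gd x) z + M * (gd x x - d x)))"
  have "convex Q" using cvx by (simp add: convex_on_def)
  then have "convex_on Q A" unfolding A_def
    by (intro convex_on_add convex_on_composite_linearization convex_on_blinfun convex_on_const[THEN iffD2] cvx)
  moreover have model: "bregman_model f gf \<Psi> d gd M x w = A w + M * d w" for w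
    by (simp add: A_def bregman_model_def bregman_def blinfun.diff_right blinfun.scaleR_left
        blinfun.minus_left algebra_simps)
  ultimately have "bregman_model f gf \<Psi> d gd M x y + M * bregman d gd y z
      \<le> bregman_model f gf \<Psi> d gd M x z"
    using three_point[OF prox _ M, of A y z] y z by (simp add: is_arg_min_linorder)
  also have "\<dots> \<le> f z + \<Psi> z + M * bregman d gd x z"
    using composite_linearization_le[OF sub, of \<Psi> x z] by (simp add: bregman_model_def)
  finally have "f y + \<Psi> y - (f z + \<Psi> z) - \<epsilon> / 2 \<le> M * (bregman d gd x z - bregman d gd y z)"
    using acc by (simp add: algebra_simps)
  then show ?thesis using M by (simp add: field_simps)
qed

text \<open>The estimating function exceeds its minimum by \<open>\<beta>\<^sub>d(x\<^sub>k, z)\<close>. Adding the new linear term to this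
  distance produces the Bregman model at \<open>x\<^sub>k\<close>, whose minimum the acceptance test compares with the
  objective.\<close>

lemma dgm_step:
  fixes Q :: "'a::real_normed_vector set"
  assumes prox: "prox_function Q d gd" and cvx: "convex_on Q \<Psi>"
    and L: "\<And>i. i \<le> k \<Longrightarrow> 0 < L (Suc i)"
    and xk: "is_arg_min (dgm_phi f gf \<Psi> d gd x0 x L k) (\<lambda>z. z \<in> Q) (x k)"
    and y: "is_arg_min (bregman_model f gf \<Psi> d gd (2 * L (Suc k)) (x k)) (\<lambda>z. z \<in> Q) y"
    and acc: "f y + \<Psi> y \<le> bregman_model f gf \<Psi> d gd (2 * L (Suc k)) (x k) y + \<epsilon> / 2"
    and z: "z \<in> Q"
  shows "dgm_phi f gf \<Psi> d gd x0 x L k (x k) + 1 / (2 * L (Suc k)) * (f y + \<Psi> y - \<epsilon> / 2)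
    \<le> dgm_phi f gf \<Psi> d gd x0 x L (Suc k) z"
proof -
  define M where "M = 2 * L (Suc k)"
  have M: "0 < M" using L[of k] by (simp add: M_def)
  have "f y + \<Psi> y - \<epsilon> / 2 \<le> bregman_model f gf \<Psi> d gd M (x k) z"
    using acc y z by (force simp: is_arg_min_linorder M_def)
  then have "1 / M * (f y + \<Psi> y - \<epsilon> / 2) \<le> 1 / M * bregman_model f gf \<Psi> d gd M (x k) z"
    using M by (intro mult_left_mono) auto
  also have "\<dots> = 1 / M * composite_linearization f gf \<Psi> (x k) z + bregman d gd (x k) z"
    using M by (simp add: bregman_model_def field_simps)
  finally have "1 / M * (f y + \<Psi> y - \<epsilon> / 2)
      \<le> 1 / M * composite_linearization f gf \<Psi> (x k) z + bregman d gd (x k) z" .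
  moreover have "dgm_phi f gf \<Psi> d gd x0 x L k (x k) + bregman d gd (x k) z
      \<le> dgm_phi f gf \<Psi> d gd x0 x L k z"
    using L by (intro dgm_phi_three_point[OF cvx prox _ xk z]) simp
  ultimately show ?thesis by (simp add: M_def)
qed

lemma dgm_phi_le:
  assumes sub: "subgradient_selection f gf" and L: "\<And>i. i < k \<Longrightarrow> 0 < L (Suc i)"
  shows "dgm_phi f gf \<Psi> d gd x0 x L k z
    \<le> bregman d gd x0 z + (\<Sum>j<k. 1 / (2 * L (Suc j)) * (f z + \<Psi> z))"
  using L
proof (induction k)
  case (Suc k)
  have "1 / (2 * L (Suc k)) * composite_linearization f gf \<Psi> (x k) z
      \<le> 1 / (2 * L (Suc k)) * (f z + \<Psi> z)"
    using Suc.prems[of k] by (intro mult_left_mono composite_linearization_le[OF sub]) auto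
  then show ?case using Suc by simp
qed simp

text \<open>Each step pays for its weighted gap by a decrease of the Bregman distance to \<open>z\<close>, so the sum
  telescopes.\<close>

lemma pgm_total:
  fixes Q :: "'a::real_normed_vector set"
  assumes compl: "complete (UNIV :: 'a set)"
    and reg: "regularity f" and fcvx: "convex_on UNIV f" and sub: "subgradient_selection f gf"
    and not_affine: "\<not> (\<exists>(g :: 'a \<Rightarrow>\<^sub>L real) c. \<forall>x. f x = blinfun_apply g x + c)"
    and cvx: "convex_on Q \<Psi>" and closed: "closed (epigraph Q \<Psi>)"
    and int: "interior Q \<noteq> {}" and prox: "prox_function Q d gd"
    and x0: "x0 \<in> Q" and z: "z \<in> Q" and e: "0 < \<epsilon>" and L0: "0 < L0" "L0 \<le> gamma_gauge f \<epsilon>"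
    and run: "pgm_run f gf Q \<Psi> d gd \<epsilon> x0 L0 k x L i"
  shows "\<And>j. j < k \<Longrightarrow> 0 < L (Suc j) \<and> L (Suc j) \<le> gamma_gauge f \<epsilon>"
    and "(\<Sum>j<k. 1 / (2 * L (Suc j)) * (f (x (Suc j)) + \<Psi> (x (Suc j)) - (f z + \<Psi> z) - \<epsilon> / 2))
      \<le> bregman d gd x0 z"
proof -
  note run' = run[unfolded pgm_run_def]
  have Lb: "0 < L j \<and> L j \<le> gamma_gauge f \<epsilon>" if "j \<le> k" for j
  proof (rule line_search_bound[where P = "\<lambda>j. pgm_accepts f gf Q \<Psi> d gd \<epsilon> (x j)" and n = k and i = i])
    show "pgm_accepts f gf Q \<Psi> d gd \<epsilon> (x j) M" if "gamma_gauge f \<epsilon> \<le> M" for j M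
      by (rule pgm_accepts_large[OF reg fcvx sub not_affine e that])
  qed (use run' L0 that in auto)
  then show "0 < L (Suc j) \<and> L (Suc j) \<le> gamma_gauge f \<epsilon>" if "j < k" for j using that by simp
  have min: "is_arg_min (bregman_model f gf \<Psi> d gd (2 * L (Suc j)) (x j)) (\<lambda>z. z \<in> Q) (x (Suc j))"
    and M: "2 * L (Suc j) = 2 ^ i j * L j" "0 < 2 * L (Suc j)" if j: "j < k" for j
  proof -
    show M: "2 * L (Suc j) = 2 ^ i j * L j" using run' j by auto
    show M0: "0 < 2 * L (Suc j)" using Lb[of "Suc j"] j by simp
    have "x (Suc j) = bregman_map f gf Q \<Psi> d gd (2 * L (Suc j)) (x j)" using run' j unfolding M by blast
    then show "is_arg_min (bregman_model f gf \<Psi> d gd (2 * L (Suc j)) (x j)) (\<lambda>z. z \<in> Q) (x (Suc j))"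
      using bregman_map_minimizes[OF compl cvx closed int prox M0] by simp
  qed
  have xQ: "x j \<in> Q" if "j \<le> k" for j
    using that min run' x0 by (cases j) (auto simp: is_arg_min_linorder)
  have step: "1 / (2 * L (Suc j)) * (f (x (Suc j)) + \<Psi> (x (Suc j)) - (f z + \<Psi> z) - \<epsilon> / 2)
      \<le> bregman d gd (x j) z - bregman d gd (x (Suc j)) z" if j: "j < k" for j
  proof (rule pgm_step[OF prox sub cvx M(2)[OF j] min[OF j] z])
    have map: "x (Suc j) = bregman_map f gf Q \<Psi> d gd (2 * L (Suc j)) (x j)"
      and "pgm_accepts f gf Q \<Psi> d gd \<epsilon> (x j) (2 * L (Suc j))" using run' j unfolding M(1)[OF j] by blast+
    then have "dgm_accepts f gf Q \<Psi> d gd \<epsilon> (x j) (2 * L (Suc j))"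
      using xQ[of j] xQ[of "Suc j"] j M(2)[OF j]
      by (intro pgm_accepts_imp_dgm_accepts[OF prox int]) auto
    then show "f (x (Suc j)) + \<Psi> (x (Suc j))
        \<le> bregman_model f gf \<Psi> d gd (2 * L (Suc j)) (x j) (x (Suc j)) + \<epsilon> / 2"
      by (simp add: dgm_accepts_def Let_def flip: map)
  qed
  have "(\<Sum>j<k. 1 / (2 * L (Suc j)) * (f (x (Suc j)) + \<Psi> (x (Suc j)) - (f z + \<Psi> z) - \<epsilon> / 2))
      \<le> (\<Sum>j<k. bregman d gd (x j) z - bregman d gd (x (Suc j)) z)"
    using step by (intro sum_mono) auto
  also have "\<dots> = bregman d gd (x 0) z - bregman d gd (x k) z" by (rule sum_lessThan_telescope')
  also have "\<dots> \<le> bregman d gd x0 z" using bregman_nonneg[OF prox int xQ[of k] z] run' by simp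
  finally show "(\<Sum>j<k. 1 / (2 * L (Suc j)) * (f (x (Suc j)) + \<Psi> (x (Suc j)) - (f z + \<Psi> z) - \<epsilon> / 2))
      \<le> bregman d gd x0 z" .
qed

text \<open>The minimum of the estimating function dominates the weighted sum of the output values up to the
  tolerance, while its value at \<open>z\<close> is at most the weighted objective there plus the initial
  Bregman distance. Acceptance and minimality are established together by induction, because
  the model inequality at \<open>x\<^sub>j\<close> needs \<open>x\<^sub>j \<in> Q\<close>.\<close>

lemma dgm_total:
  fixes Q :: "'a::real_normed_vector set"
  assumes compl: "complete (UNIV :: 'a set)"
    and reg: "regularity f" and fcvx: "convex_on UNIV f" and sub: "subgradient_selection f gf"
    and not_affine: "\<not> (\<exists>(g :: 'a \<Rightarrow>\<^sub>L real) c. \<forall>x. f x = blinfun_apply g x + c)"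
    and cvx: "convex_on Q \<Psi>" and closed: "closed (epigraph Q \<Psi>)"
    and int: "interior Q \<noteq> {}" and prox: "prox_function Q d gd"
    and x0: "x0 \<in> Q" and z: "z \<in> Q" and e: "0 < \<epsilon>" and L0: "0 < L0" "L0 \<le> gamma_gauge f \<epsilon>"
    and run: "dgm_run f gf Q \<Psi> d gd \<epsilon> x0 L0 k x y L i"
  shows "\<And>j. j < k \<Longrightarrow> 0 < L (Suc j) \<and> L (Suc j) \<le> gamma_gauge f \<epsilon>"
    and "(\<Sum>j<k. 1 / (2 * L (Suc j)) * (f (y j) + \<Psi> (y j) - (f z + \<Psi> z) - \<epsilon> / 2))
      \<le> bregman d gd x0 z"
proof -
  note run' = run[unfolded dgm_run_def]
  define \<phi> where "\<phi> = dgm_phi f gf \<Psi> d gd x0 x L"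
  have L00: "L 0 = L0" and x00: "x 0 = x0" using run' by auto
  have M: "2 * L (Suc j) = 2 ^ i j * L j" if "j < k" for j using run' that by auto
  have inv: "(\<forall>j\<le>m. 0 < L j \<and> L j \<le> gamma_gauge f \<epsilon>)
      \<and> (\<forall>j\<le>m. is_arg_min (\<phi> j) (\<lambda>z. z \<in> Q) (x j))" if "m \<le> k" for m
    using that
  proof (induction m)
    case 0
    have "is_arg_min (\<phi> 0) (\<lambda>z. z \<in> Q) x0"
      using bregman_nonneg[OF prox int x0] x0 by (auto simp: is_arg_min_linorder \<phi>_def bregman_def)
    then show ?case using L0 L00 x00 by simp
  next
    case (Suc m)
    then have m: "m < k" by simp
    have IH: "\<And>j. j \<le> m \<Longrightarrow> 0 < L j \<and> L j \<le> gamma_gauge f \<epsilon>"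
      "\<And>j. j \<le> m \<Longrightarrow> is_arg_min (\<phi> j) (\<lambda>z. z \<in> Q) (x j)" using Suc by auto
    have \<gamma>: "0 < gamma_gauge f \<epsilon>" using L0 by simp
    have Lm: "0 < L j \<and> L j \<le> gamma_gauge f \<epsilon>" if "j \<le> Suc m" for j
    proof (rule line_search_bound[where P = "\<lambda>j. dgm_accepts f gf Q \<Psi> d gd \<epsilon> (x j)" and n = "Suc m" and i = i])
      fix j M assume j: "j < Suc m" and M: "gamma_gauge f \<epsilon> \<le> M"
      have xj: "x j \<in> Q" using IH(2)[of j] j by (simp add: is_arg_min_linorder)
      have "bregman_map f gf Q \<Psi> d gd M (x j) \<in> Q"
        using bregman_map_minimizes[OF compl cvx closed int prox, of M f gf "x j"] \<gamma> M
        by (simp add: is_arg_min_linorder)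
      then show "dgm_accepts f gf Q \<Psi> d gd \<epsilon> (x j) M"
        using \<gamma> M
        by (intro pgm_accepts_imp_dgm_accepts[OF prox int xj] pgm_accepts_large[OF reg fcvx sub not_affine e]) auto
    qed (use run' m L0 that in auto)
    have "is_arg_min (\<phi> (Suc m)) (\<lambda>z. z \<in> Q)
        (dgm_trial f gf Q \<Psi> (\<phi> m) (2 * L (Suc m)) (x m))"
      unfolding \<phi>_def using Lm by (intro dgm_trial_minimizes[OF compl cvx closed int prox]) simp
    moreover have "x (Suc m) = dgm_trial f gf Q \<Psi> (\<phi> m) (2 * L (Suc m)) (x m)"
      using run' m unfolding M[OF m] \<phi>_def by blast
    ultimately have "is_arg_min (\<phi> (Suc m)) (\<lambda>z. z \<in> Q) (x (Suc m))" by simp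
    then show ?case using Lm IH(2) by (auto simp: le_Suc_eq)
  qed
  then have Lb: "0 < L (Suc j) \<and> L (Suc j) \<le> gamma_gauge f \<epsilon>" if "j < k" for j
    using that by (meson Suc_leI order_refl)
  then show "0 < L (Suc j) \<and> L (Suc j) \<le> gamma_gauge f \<epsilon>" if "j < k" for j using that by simp
  have min: "is_arg_min (\<phi> j) (\<lambda>z. z \<in> Q) (x j)" if "j \<le> k" for j using inv[of k] that by simp
  have lower: "(\<Sum>j<m. 1 / (2 * L (Suc j)) * (f (y j) + \<Psi> (y j) - \<epsilon> / 2)) \<le> \<phi> m (x m)"
    if "m \<le> k" for m
    using that
  proof (induction m)
    case 0
    show ?case by (simp add: \<phi>_def x00 bregman_def)
  next
    case (Suc m)
    then have m: "m < k" by simp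
    have ym: "y m = bregman_map f gf Q \<Psi> d gd (2 * L (Suc m)) (x m)"
      and "dgm_accepts f gf Q \<Psi> d gd \<epsilon> (x m) (2 * L (Suc m))"
      using run' m unfolding M[OF m] by blast+
    then have acc: "f (y m) + \<Psi> (y m) \<le> bregman_model f gf \<Psi> d gd (2 * L (Suc m)) (x m) (y m) + \<epsilon> / 2"
      by (simp add: dgm_accepts_def Let_def flip: ym)
    have ymin: "is_arg_min (bregman_model f gf \<Psi> d gd (2 * L (Suc m)) (x m)) (\<lambda>z. z \<in> Q) (y m)"
      unfolding ym using Lb[OF m] by (intro bregman_map_minimizes[OF compl cvx closed int prox]) simp
    have xS: "x (Suc m) \<in> Q" using min[of "Suc m"] m by (simp add: is_arg_min_linorder)
    have "\<phi> m (x m) + 1 / (2 * L (Suc m)) * (f (y m) + \<Psi> (y m) - \<epsilon> / 2) \<le> \<phi> (Suc m) (x (Suc m))"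
      unfolding \<phi>_def
    proof (rule dgm_step)
      show "is_arg_min (dgm_phi f gf \<Psi> d gd x0 x L m) (\<lambda>z. z \<in> Q) (x m)"
        using min[of m] m by (simp add: \<phi>_def)
    qed (use prox cvx ymin acc xS Lb m in auto)
    then show ?case using Suc by simp
  qed
  have "(\<Sum>j<k. 1 / (2 * L (Suc j)) * (f (y j) + \<Psi> (y j) - \<epsilon> / 2)) \<le> \<phi> k z"
    using lower[of k] min[of k] z by (force simp: is_arg_min_linorder)
  also have "\<dots> \<le> bregman d gd x0 z + (\<Sum>j<k. 1 / (2 * L (Suc j)) * (f z + \<Psi> z))"
    unfolding \<phi>_def using Lb by (intro dgm_phi_le[OF sub]) auto
  finally have upper: "(\<Sum>j<k. 1 / (2 * L (Suc j)) * (f (y j) + \<Psi> (y j) - \<epsilon> / 2))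
      \<le> bregman d gd x0 z + (\<Sum>j<k. 1 / (2 * L (Suc j)) * (f z + \<Psi> z))" .
  show "(\<Sum>j<k. 1 / (2 * L (Suc j)) * (f (y j) + \<Psi> (y j) - (f z + \<Psi> z) - \<epsilon> / 2))
      \<le> bregman d gd x0 z"
  proof -
    have "(\<Sum>j<k. 1 / (2 * L (Suc j)) * (f (y j) + \<Psi> (y j) - (f z + \<Psi> z) - \<epsilon> / 2))
        = (\<Sum>j<k. 1 / (2 * L (Suc j)) * (f (y j) + \<Psi> (y j) - \<epsilon> / 2)
            - 1 / (2 * L (Suc j)) * (f z + \<Psi> z))"
      by (intro sum.cong refl) (simp only: right_diff_distrib[symmetric], simp)
    then show ?thesis using upper unfolding sum_subtractf by linarith
  qed
qed

theorem mainTheorem8: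
  fixes f \<Psi> d :: "'a::real_normed_vector \<Rightarrow> real"
    and gf gd :: "'a \<Rightarrow> 'a \<Rightarrow>\<^sub>L real"
    and Q :: "'a set"
    and x0 xs :: 'a
    and \<epsilon> L0 D :: real
    and k :: nat
  assumes finite_dim: "\<exists>B :: 'a set. finite B \<and> span B = UNIV"
    and f_convex: "convex_on UNIV f"
    and f_not_affine: "\<not> (\<exists>(g :: 'a \<Rightarrow>\<^sub>L real) c. \<forall>x. f x = blinfun_apply g x + c)"
    and f_gradient: "subgradient_selection f gf"
    and f_regular: "regularity f"
    and Psi_convex: "convex_on Q \<Psi>"
    and Psi_closed: "closed (epigraph Q \<Psi>)"
    and dom_interior: "interior Q \<noteq> {}"
    and prox: "prox_function Q d gd"
    and x0_min: "is_arg_min d (\<lambda>x. x \<in> Q) x0"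
    and d_x0: "d x0 = 0"
    and xs_optimal: "is_arg_min (\<lambda>x. f x + \<Psi> x) (\<lambda>x. x \<in> Q) xs"
    and D_eq: "D = bregman d gd x0 xs"
    and eps_pos: "0 < \<epsilon>"
    and L0_pos: "0 < L0"
    and L0_le: "L0 \<le> gamma_gauge f \<epsilon>"
    and k_ge_1: "1 \<le> k"
  shows
    "(2 * curvature_bound f (2 * sqrt (D / real k)) \<le> \<epsilon>
        \<longleftrightarrow> real k \<ge> 4 / \<epsilon> * gamma_gauge f \<epsilon> * D)
     \<and> 4 / \<epsilon> * gamma_gauge f \<epsilon> * D = 4 * D / (complexity_gauge f (\<epsilon> / 2))\<^sup>2
     \<and> (2 * curvature_bound f (2 * sqrt (D / real k)) \<le> \<epsilon> \<longrightarrow>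
          (\<forall>x L i. pgm_run f gf Q \<Psi> d gd \<epsilon> x0 L0 k x L i \<longrightarrow>
             averaged_value (\<lambda>z. f z + \<Psi> z) L k (\<lambda>j. x (Suc j)) - (f xs + \<Psi> xs) \<le> \<epsilon>) \<and>
          (\<forall>x y L i. dgm_run f gf Q \<Psi> d gd \<epsilon> x0 L0 k x y L i \<longrightarrow>
             averaged_value (\<lambda>z. f z + \<Psi> z) L k y - (f xs + \<Psi> xs) \<le> \<epsilon>))"
proof -
  have compl: "complete (UNIV :: 'a set)" using finite_dim complete_span by metis
  have x0: "x0 \<in> Q" and xs: "xs \<in> Q" using x0_min xs_optimal by (auto simp: is_arg_min_linorder)
  have D: "0 \<le> D" unfolding D_eq by (rule bregman_nonneg[OF prox dom_interior x0 xs])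
  define s where "s = complexity_gauge f (\<epsilon> / 2)"
  note f_props = f_regular f_convex f_gradient f_not_affine
  have s: "curvature_bound f s = \<epsilon> / 2" "0 < s"
    using complexity_gauge_inverse[OF f_props] eps_pos by (auto simp: s_def)
  have gauge: "4 / \<epsilon> * gamma_gauge f \<epsilon> * D = 4 * D / s\<^sup>2"
    using eps_pos by (simp add: gamma_gauge_def s_def)
  define t where "t = 2 * sqrt (D / real k)"
  have t: "0 \<le> t" "t\<^sup>2 = 4 * D / real k" using D by (auto simp: t_def power_mult_distrib)
  have "2 * curvature_bound f t \<le> \<epsilon> \<longleftrightarrow> curvature_bound f t \<le> curvature_bound f s" using s by auto
  also have "\<dots> \<longleftrightarrow> t \<le> s"
    using curvature_bound_mono[OF f_regular t(1)] curvature_bound_strict_mono[OF f_props, of s t] s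
    by (meson less_imp_le not_le)
  also have "\<dots> \<longleftrightarrow> t\<^sup>2 \<le> s\<^sup>2" using t(1) s by (simp add: power_mono_iff)
  also have "\<dots> \<longleftrightarrow> 4 * D / s\<^sup>2 \<le> real k"
    using k_ge_1 s by (simp add: t(2) divide_le_eq mult.commute)
  finally have iff: "2 * curvature_bound f t \<le> \<epsilon> \<longleftrightarrow> 4 / \<epsilon> * gamma_gauge f \<epsilon> * D \<le> real k"
    unfolding gauge .
  note setting = compl f_props Psi_convex Psi_closed dom_interior prox x0 xs eps_pos L0_pos L0_le
  have pgm: "averaged_value (\<lambda>z. f z + \<Psi> z) L k (\<lambda>j. x (Suc j)) - (f xs + \<Psi> xs) \<le> \<epsilon>"
    if "4 / \<epsilon> * gamma_gauge f \<epsilon> * D \<le> real k" "pgm_run f gf Q \<Psi> d gd \<epsilon> x0 L0 k x L i" for x L i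
    using pgm_total[OF setting that(2)] unfolding D_eq[symmetric]
    by (intro averaged_value_gap[OF k_ge_1 _ D that(1) eps_pos])
  have dgm: "averaged_value (\<lambda>z. f z + \<Psi> z) L k y - (f xs + \<Psi> xs) \<le> \<epsilon>"
    if "4 / \<epsilon> * gamma_gauge f \<epsilon> * D \<le> real k" "dgm_run f gf Q \<Psi> d gd \<epsilon> x0 L0 k x y L i" for x y L i
    using dgm_total[OF setting that(2)] unfolding D_eq[symmetric]
    by (intro averaged_value_gap[OF k_ge_1 _ D that(1) eps_pos])
  show ?thesis using iff gauge pgm dgm unfolding t_def s_def by blast
qed

end
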